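(* For every integer $n\ge 2$ there exists a quasiisometric embedding $\psi:\mathbb{H}^n\to T\times\cdots\times T$ of the hyperbolic space $\mathbb{H}^n$ into the $2(n-1)$-fold product of binary trees.
   Context: The binary tree $T$ is the rooted tree whose vertices are the finite sequences (including the empty one, the root) with entries in $\{0,1\}$, two vertices being joined by an edge iff one is obtained from the other by erasing the last term; all edges have length 1. Products of trees carry the $l_1$-product metric (distance is the sum of the distances in the factors). *)

theory Defs
  imports Complex_Main "HOL-Library.FuncSet"
begin

text \<open>Metric spaces are given by a carrier set together with a distance function.\<close>

definition quasi_isometric_embedding ::
    "'a set \<Rightarrow> ('a \<Rightarrow> 'a \<Rightarrow> real) \<Rightarrow> 'b set \<Rightarrow> ('b \<Rightarrow> 'b \<Rightarrow> real) \<Rightarrow> ('a \<Rightarrow> 'b) \<Rightarrow> bool" where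
  "quasi_isometric_embedding X dX Y dY f \<longleftrightarrow>
     f \<in> X \<rightarrow> Y \<and>
     (\<exists>L C. L \<ge> 1 \<and> C \<ge> 0 \<and>
        (\<forall>x\<in>X. \<forall>x'\<in>X.
           dX x x' / L - C \<le> dY (f x) (f x') \<and> dY (f x) (f x') \<le> L * dX x x' + C))"


text \<open>
  Hyperbolic space as the upper sheet of the hyperboloid in \<open>(n+1)\<close>-dimensional Minkowski
  space; the coordinates are indexed by \<open>0, \<dots>, n\<close>, with \<open>0\<close> the time-like one, so that
  the distance \<open>d\<close> is given by \<open>cosh d = - minkowski n x y\<close> (curvature \<open>-1\<close>).
\<close>

definition minkowski :: "nat \<Rightarrow> (nat \<Rightarrow> real) \<Rightarrow> (nat \<Rightarrow> real) \<Rightarrow> real" where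
  "minkowski n x y = (\<Sum>i=1..n. x i * y i) - x 0 * y 0"

definition hyperbolic_space :: "nat \<Rightarrow> (nat \<Rightarrow> real) set" where
  "hyperbolic_space n = {x \<in> {0..n} \<rightarrow>\<^sub>E UNIV. minkowski n x x = -1 \<and> x 0 > 0}"

definition hyperbolic_dist :: "nat \<Rightarrow> (nat \<Rightarrow> real) \<Rightarrow> (nat \<Rightarrow> real) \<Rightarrow> real" where
  "hyperbolic_dist n x y = arcosh (- minkowski n x y)"


text \<open>
  The binary tree. Its vertices are the finite 0-1-sequences, represented as boolean lists.
  The tree is the metric graph with edges of length 1, not just its vertex set: a point is
  described by its barycentric coordinates, which are supported on the two ends of an edge;
  the vertex \<open>u\<close> is the point with coordinate 1 at \<open>u\<close>.
\<close>

definition tree_adj :: "bool list \<Rightarrow> bool list \<Rightarrow> bool" where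
  "tree_adj u v \<longleftrightarrow> (v \<noteq> [] \<and> u = butlast v) \<or> (u \<noteq> [] \<and> v = butlast u)"

definition tree_edge :: "bool list \<Rightarrow> bool list \<Rightarrow> (bool list \<Rightarrow> real) set" where
  "tree_edge u v =
     {p. p u \<ge> 0 \<and> p v \<ge> 0 \<and> p u + p v = 1 \<and> (\<forall>w. w \<notin> {u, v} \<longrightarrow> p w = 0)}"

definition binary_tree :: "(bool list \<Rightarrow> real) set" where
  "binary_tree = (\<Union>{tree_edge u v |u v. tree_adj u v})"

text \<open>
  \<open>tree_path p q l\<close>: there is a piecewise linear path of length \<open>l\<close> from \<open>p\<close> to \<open>q\<close>.
  The coordinate at \<open>u\<close> identifies the edge from \<open>u\<close> to \<open>v\<close> with the unit interval.
\<close>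

inductive tree_path :: "(bool list \<Rightarrow> real) \<Rightarrow> (bool list \<Rightarrow> real) \<Rightarrow> real \<Rightarrow> bool" where
  refl: "p \<in> binary_tree \<Longrightarrow> tree_path p p 0"
| step: "tree_path p q l \<Longrightarrow> tree_adj u v \<Longrightarrow> q \<in> tree_edge u v \<Longrightarrow> r \<in> tree_edge u v
         \<Longrightarrow> tree_path p r (l + \<bar>q u - r u\<bar>)"

definition tree_dist :: "(bool list \<Rightarrow> real) \<Rightarrow> (bool list \<Rightarrow> real) \<Rightarrow> real" where
  "tree_dist p q = Inf {l. tree_path p q l}"


definition tree_power :: "nat \<Rightarrow> (nat \<Rightarrow> bool list \<Rightarrow> real) set" where
  "tree_power k = ({..<k} \<rightarrow>\<^sub>E binary_tree)"

definition tree_power_dist ::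
    "nat \<Rightarrow> (nat \<Rightarrow> bool list \<Rightarrow> real) \<Rightarrow> (nat \<Rightarrow> bool list \<Rightarrow> real) \<Rightarrow> real" where
  "tree_power_dist k p q = (\<Sum>i<k. tree_dist (p i) (q i))"

end

theory Submission
  imports Defs "HOL-Library.Sublist"
begin

text \<open>
  In horospherical coordinates \<open>(x\<^sub>1, \<dots>, x\<^sub>n\<^sub>-\<^sub>1, t)\<close> a point of hyperbolic space has \<open>n - 1\<close> shadows
  \<open>(x\<^sub>m, t)\<close> in the hyperbolic plane. Up to a bounded error the distance is the logarithm of the
  negated Minkowski form. For two points that form is \<open>P + \<Sum>m. s\<^sub>m\<close> with \<open>P \<ge> 1\<close> and \<open>s\<^sub>m \<ge> 0\<close>,
  and for their \<open>m\<close>-th shadows it is \<open>P + s\<^sub>m\<close>. As \<open>P + s\<^sub>m \<le> P + \<Sum>m. s\<^sub>m \<le> \<Prod>m. (P + s\<^sub>m)\<close>, the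
  shadows together form a quasiisometric embedding into a product of \<open>n - 1\<close> hyperbolic planes
  (lemmas \<open>slice_forms\<close> and \<open>ln_add_sum_le\<close>). It remains to embed the plane into two trees.

  A point of the plane has polar coordinates: an angle \<open>x\<close> in \<open>\<real>/\<int>\<close> and a radius, which is
  measured by the level \<open>k\<close> with \<open>5\<^sup>k\<close> comparable to the \<open>cosh\<close> of the radius. Up to affine bounds, the
  distance of two points of levels \<open>k\<close> and \<open>k'\<close> is \<open>k + k' - 2j\<close>, where \<open>j \<le> min k k'\<close> is the last level at which
  the angles are still \<open>5\<^sup>-\<^sup>j\<close>-close. The base 5 digits of \<open>x\<close> up to level \<open>k\<close> are a vertex of a
  tree, but close angles can have very different digits, on the two sides of a boundary
  point of a cell. This is cured by recording only the digits 1, 2, 3: next to a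
  boundary point all further digits are 0 or 4, so at most one recorded digit on either side
  is affected by crossing it. What one tree omits the other one sees, if it uses the digits of \<open>x + 1/2\<close>: on each
  level at least one of the two digits is recorded (\<open>every_level_written\<close>).

  The recorded digits alone do not determine how many levels lie between two of them, nor
  the digits that were left out; two points could agree in their records although they
  separated long ago. So each record also makes up for a bounded number of levels that were left
  out, the most recent ones first: the levels without a record wait on a stack, and every
  record includes the sixteen topmost waiting levels. In this way the word of records
  determines a long uninterrupted final stretch of levels as soon as records have been
  frequent (\<open>diary_determines_entries\<close>). A bit that depends on the level, chosen so that it
  detects every shift by \<open>D\<close> inside every window of length \<open>4D\<close>, turns this relative
  information into an absolute one (\<open>diary_determines_recent\<close>).

  Suppose now that two points separate at level \<open>j\<close>, and that the larger of \<open>k - j\<close> and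
  \<open>k' - j\<close> is \<open>k - j\<close>. One of the two colours records at least half of the levels between \<open>j\<close>
  and \<open>k\<close>. If the two words of that colour agreed except for a small fraction of \<open>k - j\<close>
  letters at their ends, then the last \<open>5(k - j)\<close> levels before some level \<open>t > j\<close> (all of
  them, if there are fewer), in particular those beyond \<open>j\<close>, could be read off from the common
  part, so the digits of the two points at the level where they separate would be the same (\<open>branch_dist_color_ge\<close>). Hence the trees see a fixed proportion of the distance.
  Writing the letters as binary words of a fixed length finally leads to the binary tree.
\<close>

section \<open>Distances between vertices of the binary tree\<close>

text \<open>
  The path metric on the vertices of a rooted tree whose vertices are lists.
\<close>

definition branch_dist :: "'a list \<Rightarrow> 'a list \<Rightarrow> nat" where
  "branch_dist u v = (length u - length (longest_common_prefix u v))
                     + (length v - length (longest_common_prefix u v))"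

definition vertex :: "bool list \<Rightarrow> bool list \<Rightarrow> real" where
  "vertex u = (\<lambda>w. if w = u then 1 else 0)"

lemma branch_dist_self [simp]: "branch_dist u u = 0"
proof -
  have "prefix u (longest_common_prefix u u)"
    by (rule longest_common_prefix_max_prefix) auto
  then show ?thesis
    using prefix_length_le unfolding branch_dist_def by fastforce
qed

lemma branch_dist_commute: "branch_dist u v = branch_dist v u"
proof -
  have "longest_common_prefix u v = longest_common_prefix v u"
    by (meson longest_common_prefix_max_prefix longest_common_prefix_prefix1
        longest_common_prefix_prefix2 prefix_order.antisym)
  then show ?thesis unfolding branch_dist_def by simp
qed

lemma length_lcp_le:
  "length (longest_common_prefix u v) \<le> length u"
  "length (longest_common_prefix u v) \<le> length v"
  by (simp_all add: longest_common_prefix_prefix1 longest_common_prefix_prefix2 prefix_length_le)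

lemma length_lcp_ge:
  "prefix z u \<Longrightarrow> prefix z v \<Longrightarrow> length z \<le> length (longest_common_prefix u v)"
  by (simp add: longest_common_prefix_max_prefix prefix_length_le)

lemma branch_dist_le:
  "prefix z u \<Longrightarrow> prefix z v \<Longrightarrow> branch_dist u v \<le> (length u - length z) + (length v - length z)"
  using length_lcp_ge[of z u v] length_lcp_le[of u v] unfolding branch_dist_def by linarith

lemma branch_dist_snoc:
  "\<bar>real (branch_dist u (v @ [b])) - real (branch_dist u v)\<bar> = 1"
proof -
  define l where "l = longest_common_prefix u v"
  define l' where "l' = longest_common_prefix u (v @ [b])"
  have pl: "prefix l u" "prefix l v" "prefix l' u" "prefix l' (v @ [b])"
    unfolding l_def l'_def
    by (rule longest_common_prefix_prefix1 longest_common_prefix_prefix2)+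
  have ll: "length l \<le> length l'" unfolding l'_def
    by (rule length_lcp_ge) (use pl in auto)
  from pl(4) have "l' = v @ [b] \<or> prefix l' v" by (simp only: prefix_snoc)
  then show ?thesis
  proof
    assume e: "l' = v @ [b]"
    then have "prefix v u" using pl(3) by (meson append_prefixD)
    then have "length v \<le> length l" unfolding l_def by (rule length_lcp_ge) simp
    then have lv: "length l = length v" using prefix_length_le[OF pl(2)] by simp
    have "length l' \<le> length u" using prefix_length_le[OF pl(3)] .
    then show ?thesis using e lv
      unfolding branch_dist_def l_def[symmetric] l'_def[symmetric] by (simp add: of_nat_diff)
  next
    assume p: "prefix l' v"
    then have "length l' \<le> length l" unfolding l_def
      using length_lcp_ge pl(3) by blast
    then have e: "length l' = length l" using ll by simp
    have "length l \<le> length v" using prefix_length_le[OF pl(2)] .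
    then show ?thesis using e
      unfolding branch_dist_def l_def[symmetric] l'_def[symmetric] by (simp add: of_nat_diff)
  qed
qed

lemma branch_dist_adj:
  assumes "tree_adj v w"
  shows "\<bar>real (branch_dist u v) - real (branch_dist u w)\<bar> = 1"
  using assms branch_dist_snoc[of u v "last w"] branch_dist_snoc[of u w "last v"]
  unfolding tree_adj_def by (auto simp: abs_minus_commute)

lemma tree_adj_neq: "tree_adj u v \<Longrightarrow> u \<noteq> v"
  unfolding tree_adj_def by (metis append_butlast_last_id not_Cons_self2 append_self_conv)

lemma tree_adj_snoc: "tree_adj v (v @ [b])" "tree_adj (v @ [b]) v"
  unfolding tree_adj_def by auto

lemma vertex_in_edge: "u \<noteq> v \<Longrightarrow> vertex u \<in> tree_edge u v" "u \<noteq> v \<Longrightarrow> vertex v \<in> tree_edge u v"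
  unfolding tree_edge_def vertex_def by auto

lemma vertex_in_tree: "vertex u \<in> binary_tree"
  unfolding binary_tree_def
  using vertex_in_edge(1)[of u "u @ [True]"] tree_adj_snoc(1)[of u True] by blast

text \<open>
  The distance from the vertex \<open>u\<close>, extended affinely to the edges. It changes by at most the
  length of a path along the path, which gives the lower bound for the tree metric.
\<close>

definition dist_from :: "bool list \<Rightarrow> (bool list \<Rightarrow> real) \<Rightarrow> real" where
  "dist_from u p = (\<Sum>w | p w \<noteq> 0. p w * real (branch_dist u w))"

lemma dist_from_edge:
  assumes "p \<in> tree_edge v w" "v \<noteq> w"
  shows "dist_from u p = p v * real (branch_dist u v) + p w * real (branch_dist u w)"
proof -
  have "dist_from u p = (\<Sum>x\<in>{v, w}. p x * real (branch_dist u x))"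
    unfolding dist_from_def
    by (rule sum.mono_neutral_left) (use assms in \<open>auto simp: tree_edge_def\<close>)
  then show ?thesis using assms(2) by simp
qed

lemma dist_from_vertex [simp]: "dist_from u (vertex v) = real (branch_dist u v)"
  using dist_from_edge[OF vertex_in_edge(1)[of v "v @ [True]"], of u]
  by (simp add: vertex_def)

lemma tree_path_ge:
  assumes "tree_path p q l"
  shows "\<bar>dist_from u q - dist_from u p\<bar> \<le> l"
  using assms
proof induction
  case (refl p)
  then show ?case by simp
next
  case (step p q l v w r)
  have vw: "v \<noteq> w" using tree_adj_neq step.hyps by blast
  have s: "q w = 1 - q v" "r w = 1 - r v"
    using step.hyps unfolding tree_edge_def by auto
  have "dist_from u r - dist_from u q
      = (q v - r v) * (real (branch_dist u w) - real (branch_dist u v))"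
    unfolding dist_from_edge[OF step.hyps(3) vw] dist_from_edge[OF step.hyps(4) vw] s
    by (simp add: algebra_simps)
  then have "\<bar>dist_from u r - dist_from u q\<bar> = \<bar>q v - r v\<bar>"
    using branch_dist_adj[OF step.hyps(2), of u] by (simp add: abs_mult abs_minus_commute)
  then show ?case using step.IH by linarith
qed

lemma tree_path_ascend:
  "tree_path p (vertex (z @ ys)) l \<Longrightarrow> tree_path p (vertex z) (l + real (length ys))"
proof (induction ys arbitrary: l rule: rev_induct)
  case Nil
  then show ?case by simp
next
  case (snoc b ys)
  have ne: "z @ ys \<noteq> (z @ ys) @ [b]" by simp
  have "tree_path p (vertex (z @ ys))
      (l + \<bar>vertex ((z @ ys) @ [b]) (z @ ys) - vertex (z @ ys) (z @ ys)\<bar>)"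
    by (rule tree_path.step[OF _ tree_adj_snoc(1) vertex_in_edge(2)[OF ne] vertex_in_edge(1)[OF ne]])
      (use snoc.prems in simp)
  then have "tree_path p (vertex (z @ ys)) (l + 1)" by (simp add: vertex_def)
  from snoc.IH[OF this] show ?case by (simp add: algebra_simps)
qed

lemma tree_path_descend:
  "tree_path p (vertex z) l \<Longrightarrow> tree_path p (vertex (z @ ys)) (l + real (length ys))"
proof (induction ys rule: rev_induct)
  case Nil
  then show ?case by simp
next
  case (snoc b ys)
  have ne: "z @ ys \<noteq> (z @ ys) @ [b]" by simp
  have "tree_path p (vertex ((z @ ys) @ [b]))
      (l + real (length ys) + \<bar>vertex (z @ ys) (z @ ys) - vertex ((z @ ys) @ [b]) (z @ ys)\<bar>)"
    by (rule tree_path.step[OF _ tree_adj_snoc(1) vertex_in_edge(1)[OF ne] vertex_in_edge(2)[OF ne]])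
      (use snoc in simp)
  then show ?case by (simp add: vertex_def algebra_simps)
qed

lemma tree_dist_vertex: "tree_dist (vertex u) (vertex v) = real (branch_dist u v)"
proof -
  define z where "z = longest_common_prefix u v"
  obtain us where us: "u = z @ us"
    using longest_common_prefix_prefix1[of u v] unfolding z_def prefix_def by auto
  obtain vs where vs: "v = z @ vs"
    using longest_common_prefix_prefix2[of u v] unfolding z_def prefix_def by auto
  have "tree_path (vertex u) (vertex z) (0 + real (length us))"
    by (rule tree_path_ascend) (use us tree_path.refl[OF vertex_in_tree] in simp)
  then have "tree_path (vertex u) (vertex v) (0 + real (length us) + real (length vs))"
    using tree_path_descend vs by blast
  moreover have "branch_dist u v = length us + length vs"
    unfolding branch_dist_def z_def[symmetric] using us vs by (metis add_diff_cancel_left' length_append)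
  ultimately have path: "tree_path (vertex u) (vertex v) (real (branch_dist u v))" by simp
  have low: "real (branch_dist u v) \<le> l" if "tree_path (vertex u) (vertex v) l" for l
    using tree_path_ge[OF that, of u] by simp
  show ?thesis unfolding tree_dist_def
    by (rule cInf_eq_minimum) (use path low in auto)
qed

section \<open>A sequence that detects shifts\<close>

text \<open>
  The period-doubling sequence: for \<open>n > 0\<close>, whether the exponent of 2 in \<open>n\<close> is even.
\<close>

fun ruler :: "nat \<Rightarrow> bool" where
  "ruler n = (if n = 0 then False else if odd n then True else \<not> ruler (n div 2))"

declare ruler.simps [simp del]

lemma ruler_odd: "odd n \<Longrightarrow> ruler n"
  by (subst ruler.simps) (auto simp: odd_pos)

lemma ruler_double: "0 < n \<Longrightarrow> ruler (2 * n) \<longleftrightarrow> \<not> ruler n"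
  by (subst ruler.simps) auto

text \<open>
  If \<open>2\<^sup>v\<close> is the exact power of 2 in \<open>D\<close>, one of the residue classes of \<open>2\<^sup>v\<close> and \<open>3 \<cdot> 2\<^sup>v\<close> modulo
  \<open>2\<^sup>v\<^sup>+\<^sup>2\<close> consists of numbers \<open>s\<close> such that \<open>s + D\<close> contains \<open>2\<^sup>v\<^sup>+\<^sup>1\<close> exactly. The induction halves
  \<open>D\<close> until it is odd.
\<close>

lemma ruler_shift_detected:
  assumes "0 < D"
  shows "\<exists>s. b \<le> s \<and> s < b + 4 * D \<and> 0 < s \<and> ruler s \<noteq> ruler (s + D)"
  using assms
proof (induction D arbitrary: b rule: less_induct)
  case (less D)
  show ?case
  proof (cases "odd D")
    case True
    have "\<exists>s. b \<le> s \<and> s < b + 4 \<and> odd s \<and> (s + D) mod 4 = 2"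
      using True by presburger
    then obtain s where s: "b \<le> s" "s < b + 4" "odd s" "(s + D) mod 4 = 2" by blast
    have e: "s + D = 2 * ((s + D) div 2)" "odd ((s + D) div 2)" using s(4) by presburger+
    have "\<not> ruler (s + D)"
      using ruler_double[of "(s + D) div 2"] ruler_odd[OF e(2)] e(1) odd_pos[OF e(2)] by simp
    moreover have "s < b + 4 * D" using s(2) less.prems by linarith
    ultimately show ?thesis using s ruler_odd[OF s(3)] odd_pos[OF s(3)] by blast
  next
    case False
    then obtain E where E: "D = 2 * E" by (auto elim: evenE)
    then have E0: "0 < E" "E < D" using less.prems by auto
    from less.IH[OF E0(2) E0(1), of "(b + 1) div 2"] obtain s where
      s: "(b + 1) div 2 \<le> s" "s < (b + 1) div 2 + 4 * E" "0 < s" "ruler s \<noteq> ruler (s + E)" by blast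
    have "ruler (2 * s) \<noteq> ruler (2 * s + D)"
      using s(3,4) ruler_double[of s] ruler_double[of "s + E"] E by simp
    moreover have "b \<le> 2 * s" "2 * s < b + 4 * D" "0 < 2 * s" using s E by linarith+
    ultimately show ?thesis by blast
  qed
qed

section \<open>Diaries\<close>

text \<open>
  Digits that are not written are those of the outermost subcells, which touch the boundary of
  the cell.
\<close>

definition written :: "int \<Rightarrow> bool" where
  "written a \<longleftrightarrow> a \<noteq> 0 \<and> a \<noteq> 4"

type_synonym entry = "int \<times> nat \<times> bool"

text \<open>
  Lists of digits are histories, with the newest digit at the head. The kind of a history tells
  whether it is empty and, if not, whether its newest digit is written; stored along with the
  next digit, it allows a history to be read backwards.
\<close>

fun kind :: "int list \<Rightarrow> nat" where
  "kind [] = 0"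
| "kind (a # h) = (if written a then 1 else 2)"

definition entry :: "int \<Rightarrow> int list \<Rightarrow> entry" where
  "entry a h = (a, kind h, ruler (length h))"

fun entries :: "int list \<Rightarrow> entry list" where
  "entries [] = []"
| "entries (a # h) = entry a h # entries h"

text \<open>
  The stack of levels that are not yet recorded. A written digit removes the topmost sixteen,
  and the diary receives them together with the new level. Most recent levels come first, since
  the diary must reveal what happened shortly before the two points separated without waiting
  for older levels.
\<close>

fun backlog :: "int list \<Rightarrow> entry list" where
  "backlog [] = []"
| "backlog (a # h) = (if written a then drop 16 (backlog h) else entry a h # backlog h)"

fun diary :: "int list \<Rightarrow> entry list list" where
  "diary [] = []"
| "diary (a # h) = (if written a then (entry a h # take 16 (backlog h)) # diary h else diary h)"

lemma length_diary: "length (diary h) = length (filter written h)"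
  by (induction h) auto

lemma length_entries [simp]: "length (entries h) = length h"
  by (induction h) auto

lemma entries_nth: "i < length h \<Longrightarrow> entries h ! i = entry (h ! i) (drop (Suc i) h)"
  by (induction h arbitrary: i) (auto simp: nth_Cons split: nat.split)

lemma entry_inject:
  "entry a h = entry a' h' \<Longrightarrow> a = a' \<and> kind h = kind h' \<and> ruler (length h) = ruler (length h')"
  by (simp add: entry_def)

text \<open>
  Run the process backwards, on both histories at once. The number \<open>u\<close> counts the topmost levels
  of the stack that are known to agree: undoing a written level puts sixteen known levels back on the
  stack, undoing another level takes one away. The last hypothesis, a balance of \<open>16\<close> levels
  gained against \<open>1\<close> level lost, says that the supply does not run out within \<open>L\<close> steps.
\<close>

lemma diary_determines_entries:
  assumes "diary h = diary h'" "kind h = kind h'" "take u (backlog h) = take u (backlog h')"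
    and "\<And>i. i \<le> L \<Longrightarrow> length (take i h) \<le> u + 17 * length (filter written (take i h))"
  shows "take L (entries h) = take L (entries h')"
  using assms
proof (induction L arbitrary: u h h')
  case 0
  then show ?case by simp
next
  case (Suc L)
  show ?case
  proof (cases h)
    case Nil
    then have "h' = []" using Suc.prems(2) by (cases h') (auto split: if_splits)
    then show ?thesis using Nil by simp
  next
    case h: (Cons a g)
    then obtain a' g' where h': "h' = a' # g'"
      using Suc.prems(2) by (cases h') (auto split: if_splits)
    have w: "written a = written a'"
      using Suc.prems(2) h h' by (auto split: if_splits)
    have bound: "Suc (length (take i g)) \<le> u + 17 * length (filter written (a # take i g))"
      if "i \<le> L" for i
      using Suc.prems(4)[of "Suc i"] that h by simp
    show ?thesis
    proof (cases "written a")
      case True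
      have eq: "entry a g = entry a' g'" "take 16 (backlog g) = take 16 (backlog g')" "diary g = diary g'"
        using Suc.prems(1) h h' w True by auto
      have "take u (drop 16 (backlog g)) = take u (drop 16 (backlog g'))"
        using Suc.prems(3) h h' w True by simp
      then have "take (16 + u) (backlog g) = take (16 + u) (backlog g')"
        unfolding take_add using eq(2) by simp
      moreover have "length (take i g) \<le> (16 + u) + 17 * length (filter written (take i g))"
        if "i \<le> L" for i
        using bound[OF that] True by simp
      ultimately have "take L (entries g) = take L (entries g')"
        using Suc.IH eq(3) entry_inject[OF eq(1)] by blast
      then show ?thesis using h h' eq(1) by simp
    next
      case False
      have "1 \<le> u" using bound[of 0] False by simp
      then obtain v where v: "u = Suc v" by (cases u) auto
      have eq: "entry a g = entry a' g'" "take v (backlog g) = take v (backlog g')" "diary g = diary g'"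
        using Suc.prems(1,3) h h' w False v by auto
      have "length (take i g) \<le> v + 17 * length (filter written (take i g))"
        if "i \<le> L" for i
        using bound[OF that] False v by simp
      then have "take L (entries g) = take L (entries g')"
        using Suc.IH eq(2,3) entry_inject[OF eq(1)] by blast
      then show ?thesis using h h' eq(1) by simp
    qed
  qed
qed

lemma take_eq_nthD: "take L xs = take L ys \<Longrightarrow> i < L \<Longrightarrow> xs ! i = ys ! i"
  by (metis nth_take)

text \<open>
  Equal entries at a shift of \<open>D\<close> levels would make the level bits \<open>D\<close>-periodic on a window
  of length at least \<open>4D\<close>.
\<close>

lemma equal_entries_same_length:
  assumes eq: "take L (entries h) = take L (entries h')"
    and len: "length h \<le> length h'" "4 * (length h' - length h) \<le> L"
  shows "length h = length h'"
proof (rule ccontr)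
  assume ne: "length h \<noteq> length h'"
  define D where "D = length h' - length h"
  have D: "0 < D" "length h' = length h + D" "4 * D \<le> L" using ne len unfolding D_def by auto
  have "min L (length h) = min L (length h')"
    using arg_cong[OF eq, of length] by (simp add: min.commute)
  then have L: "L \<le> length h" using D by linarith
  obtain s where s: "length h - L \<le> s" "s < length h - L + 4 * D" "ruler s \<noteq> ruler (s + D)"
    using ruler_shift_detected[OF D(1), of "length h - L"] by blast
  define i where "i = length h - 1 - s"
  have i: "i < L" "i < length h" "length h - Suc i = s" "length h' - Suc i = s + D"
    using s L D unfolding i_def by linarith+
  have "entry (h ! i) (drop (Suc i) h) = entry (h' ! i) (drop (Suc i) h')"
    using take_eq_nthD[OF eq i(1)] i(2) D(2) by (simp add: entries_nth)
  then show False using s(3) i by (simp add: entry_def)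
qed

lemma diary_determines_recent:
  assumes "diary h = diary h'" "kind h = 1" "kind h' = 1"
    and cover: "\<And>i. i \<le> L \<Longrightarrow> length (take i h) \<le> 17 * length (filter written (take i h))"
    and "4 * (length h' - length h) \<le> L" "4 * (length h - length h') \<le> L"
  shows "length h = length h'" and "\<And>i. i < L \<Longrightarrow> i < length h \<Longrightarrow> h ! i = h' ! i"
proof -
  have eq: "take L (entries h) = take L (entries h')"
    by (rule diary_determines_entries[where u = 0]) (use assms in auto)
  show len: "length h = length h'"
    using equal_entries_same_length[OF eq] equal_entries_same_length[OF eq[symmetric]] assms(5,6)
    by linarith
  show "h ! i = h' ! i" if "i < L" "i < length h" for i
    using take_eq_nthD[OF eq that(1)] that(2) len entry_inject by (simp add: entries_nth)
qed

section \<open>Digits of points of the circle\<close>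

text \<open>
  The number of the interval of length \<open>5\<^sup>-\<^sup>i\<close> that contains \<open>x\<close>, for the grid moved by \<open>s\<close>. The two
  colours are \<open>s = 0\<close> and \<open>s = 1/2\<close>.
\<close>

definition cell :: "real \<Rightarrow> real \<Rightarrow> nat \<Rightarrow> int" where
  "cell s x i = \<lfloor>5 ^ i * (x + s)\<rfloor>"

fun digits :: "real \<Rightarrow> real \<Rightarrow> nat \<Rightarrow> int list" where
  "digits s x 0 = []"
| "digits s x (Suc k) = cell s x (Suc k) mod 5 # digits s x k"

lemma length_digits [simp]: "length (digits s x k) = k"
  by (induction k) auto

lemma digits_nth: "i < k \<Longrightarrow> digits s x k ! i = cell s x (k - i) mod 5"
  by (induction k arbitrary: i) (auto simp: nth_Cons split: nat.split)

lemma drop_digits: "i \<le> k \<Longrightarrow> drop i (digits s x k) = digits s x (k - i)"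
  by (induction k arbitrary: i) (auto simp: drop_Cons split: nat.split)

lemma cell_Suc: "cell s x (Suc i) = 5 * cell s x i + cell s x (Suc i) mod 5"
proof -
  have "\<lfloor>5 ^ Suc i * (x + s) / 5\<rfloor> = \<lfloor>5 ^ Suc i * (x + s)\<rfloor> div 5"
    using floor_divide_real_eq_div[of 5 "5 ^ Suc i * (x + s)"] by simp
  then have "cell s x (Suc i) div 5 = cell s x i" by (simp add: cell_def)
  then show ?thesis using mult_div_mod_eq[of 5 "cell s x (Suc i)"] by simp
qed

lemma digits_add_int: "digits s (x + of_int z) k = digits s x k"
proof (induction k)
  case (Suc k)
  have "5 ^ Suc k * (x + of_int z + s) = 5 ^ Suc k * (x + s) + of_int (5 ^ Suc k * z)"
    by (simp add: algebra_simps)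
  then have "cell s (x + of_int z) (Suc k) = cell s x (Suc k) + 5 ^ Suc k * z"
    unfolding cell_def by (metis floor_add_int)
  then have "cell s (x + of_int z) (Suc k) = cell s x (Suc k) + (5 ^ k * z) * 5" by simp
  then have "cell s (x + of_int z) (Suc k) mod 5 = cell s x (Suc k) mod 5" by (simp only: mod_mult_self1)
  then show ?case using Suc by simp
qed simp

text \<open>
  Equal digits mean equal cells up to an integer translation, because the cell of level 0 does
  not count as a digit.
\<close>

lemma digits_agree_imp_close:
  assumes "digits s x j = digits s y j"
  shows "\<exists>z. \<bar>y - x - of_int z\<bar> * 5 ^ j < 1"
proof -
  define z where "z = cell s y 0 - cell s x 0"
  have "cell s y j - cell s x j = 5 ^ j * z"
    using assms
  proof (induction j)
    case (Suc j)
    then have "cell s y j - cell s x j = 5 ^ j * z" "cell s y (Suc j) mod 5 = cell s x (Suc j) mod 5"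
      by auto
    then show ?case using cell_Suc[of s x j] cell_Suc[of s y j] by (simp add: algebra_simps)
  qed (simp add: z_def)
  then have "real_of_int (cell s y j - cell s x j) = real_of_int (5 ^ j * z)" by (rule arg_cong)
  then have e: "real_of_int (cell s y j) = real_of_int (cell s x j) + 5 ^ j * real_of_int z" by simp
  have "\<bar>5 ^ j * (y + s) - real_of_int (cell s y j) - (5 ^ j * (x + s) - real_of_int (cell s x j))\<bar> < 1"
    unfolding cell_def by linarith
  then have "\<bar>5 ^ j * (y - x - real_of_int z)\<bar> < 1" using e by (simp add: algebra_simps)
  then have "\<bar>y - x - real_of_int z\<bar> * 5 ^ j < 1" by (simp add: abs_mult mult.commute)
  then show ?thesis by blast
qed

lemma close_imp_adjacent_cells:
  assumes "\<bar>y - x\<bar> * 5 ^ j < 1" "i \<le> j"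
  shows "\<bar>cell s y i - cell s x i\<bar> \<le> 1"
proof -
  have "\<bar>y - x\<bar> * 5 ^ i \<le> \<bar>y - x\<bar> * 5 ^ j"
    using assms(2) by (intro mult_left_mono power_increasing) auto
  moreover have "5 ^ i * (y + s) - 5 ^ i * (x + s) = (y - x) * 5 ^ i" by (simp add: algebra_simps)
  ultimately have "\<bar>5 ^ i * (y + s) - 5 ^ i * (x + s)\<bar> < 1"
    using assms(1) by (simp add: abs_mult)
  then show ?thesis unfolding cell_def by linarith
qed

text \<open>
  As long as the cells agree, so do the diaries. At the first level where the cells are different
  neighbours, at most one letter is written in each diary; from then on the two points lie on both
  sides of a boundary point and nothing is written. In each of these levels the last digits
  differ.
\<close>

lemma adjacent_cells_diaries:
  assumes "\<And>i. i \<le> j \<Longrightarrow> \<bar>cell s y i - cell s x i\<bar> \<le> 1"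
  shows "if cell s x j = cell s y j then digits s x j = digits s y j
         else (0 < j \<longrightarrow> cell s x j mod 5 \<noteq> cell s y j mod 5) \<and>
              (\<exists>u v w. diary (digits s x j) = v @ u \<and> diary (digits s y j) = w @ u
                       \<and> length v \<le> 1 \<and> length w \<le> 1)"
  using assms
proof (induction j)
  case 0
  then show ?case by auto
next
  case (Suc j)
  define a b where "a = cell s x (Suc j) mod 5" and "b = cell s y (Suc j) mod 5"
  have ab: "0 \<le> a" "a \<le> 4" "0 \<le> b" "b \<le> 4" unfolding a_def b_def
    by (simp_all add: zless_imp_add1_zle[of _ 5, simplified])
  have cells: "cell s x (Suc j) = 5 * cell s x j + a" "cell s y (Suc j) = 5 * cell s y j + b"
    using cell_Suc unfolding a_def b_def by auto
  have near: "\<bar>cell s y (Suc j) - cell s x (Suc j)\<bar> \<le> 1" using Suc.prems by simp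
  have near': "\<bar>cell s y j - cell s x j\<bar> \<le> 1" using Suc.prems by simp
  have IH: "if cell s x j = cell s y j then digits s x j = digits s y j
     else (0 < j \<longrightarrow> cell s x j mod 5 \<noteq> cell s y j mod 5) \<and>
              (\<exists>u v w. diary (digits s x j) = v @ u \<and> diary (digits s y j) = w @ u
                       \<and> length v \<le> 1 \<and> length w \<le> 1)"
    using Suc.IH Suc.prems by simp
  show ?case
  proof (cases "cell s x j = cell s y j")
    case True
    then have same: "digits s x j = digits s y j" using IH by simp
    have "\<exists>u v w. diary (digits s x (Suc j)) = v @ u \<and> diary (digits s y (Suc j)) = w @ u
                       \<and> length v \<le> 1 \<and> length w \<le> 1"
      by (rule exI[of _ "diary (digits s x j)"])
        (use same in \<open>auto simp: Let_def split: if_splits\<close>)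
    moreover have "cell s x (Suc j) = cell s y (Suc j) \<longleftrightarrow> a = b" using cells True by simp
    ultimately show ?thesis using same unfolding a_def b_def by auto
  next
    case False
    \<comment> \<open>Once the cells are neighbours they stay neighbours, and then one point has the last digit
      and the other the first: neither is written.\<close>
    have "cell s y j = cell s x j + 1 \<or> cell s x j = cell s y j + 1" using False near' by linarith
    then have "a = 4 \<and> b = 0 \<or> a = 0 \<and> b = 4"
      using near ab unfolding cells by linarith
    then have *: "a \<noteq> b \<and> \<not> written a \<and> \<not> written b \<and> cell s x (Suc j) \<noteq> cell s y (Suc j)"
      using False cells near near' unfolding written_def by auto
    then have "diary (digits s x (Suc j)) = diary (digits s x j)"
      "diary (digits s y (Suc j)) = diary (digits s y j)"
      unfolding a_def b_def by auto
    then show ?thesis using IH False * unfolding a_def b_def by simp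
  qed
qed

text \<open>
  Moving by \<open>1/2\<close> adds \<open>5\<^sup>i/2\<close>, which is \<open>5/2\<close> modulo 5, to the number of the cell. So the digits 4 and 0
  become one of 1, 2, 3.
\<close>

lemma every_level_written:
  "written (cell 0 x i mod 5) \<or> written (cell (1/2) x i mod 5)" if "0 < i"
proof -
  define t where "t = 5 ^ i * x"
  have "\<exists>m::nat. (5::real) ^ Suc k = 10 * real m + 5" for k
  proof (induction k)
    case 0
    show ?case by (rule exI[of _ 0]) simp
  next
    case (Suc k)
    then obtain m :: nat where "(5::real) ^ Suc k = 10 * real m + 5" by blast
    then have "(5::real) ^ Suc (Suc k) = 10 * real (5 * m + 2) + 5" by simp
    then show ?case by blast
  qed
  moreover have "i = Suc (i - 1)" using that by simp
  ultimately obtain m :: nat where "(5::real) ^ i = 10 * real m + 5" by metis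
  then have "5 ^ i * (x + 1/2) = t + 5/2 + real_of_int (5 * int m)"
    unfolding t_def by (simp add: algebra_simps)
  then have c2: "cell (1/2) x i = \<lfloor>t + 5/2\<rfloor> + 5 * int m"
    unfolding cell_def by (simp only: floor_add_int)
  have c1: "cell 0 x i = \<lfloor>t\<rfloor>" by (simp add: cell_def t_def)
  have "\<lfloor>t + 5/2\<rfloor> = \<lfloor>t\<rfloor> + 2 \<or> \<lfloor>t + 5/2\<rfloor> = \<lfloor>t\<rfloor> + 3" by linarith
  moreover have "(\<lfloor>t + 5/2\<rfloor> + 5 * int m) mod 5 = \<lfloor>t + 5/2\<rfloor> mod 5" by simp
  ultimately have c2': "cell (1/2) x i mod 5 = (\<lfloor>t\<rfloor> mod 5 + 2) mod 5
      \<or> cell (1/2) x i mod 5 = (\<lfloor>t\<rfloor> mod 5 + 3) mod 5"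
    unfolding c2 by (auto simp: mod_add_left_eq)
  show ?thesis
  proof (cases "\<lfloor>t\<rfloor> mod 5 = 0 \<or> \<lfloor>t\<rfloor> mod 5 = 4")
    case True
    then show ?thesis using c2' unfolding written_def by auto
  next
    case False
    then show ?thesis unfolding c1 written_def by simp
  qed
qed

lemma close_digits:
  assumes "\<bar>y - x - of_int z\<bar> * 5 ^ j < 1"
  shows "digits s x j = digits s y j \<or>
         (0 < j \<and> digits s x j ! 0 \<noteq> digits s y j ! 0)"
    and "\<exists>u v w. diary (digits s x j) = v @ u \<and> diary (digits s y j) = w @ u
                       \<and> length v \<le> 1 \<and> length w \<le> 1"
proof -
  define y' where "y' = y - of_int z"
  have dy: "digits s y' j = digits s y j"
    using digits_add_int[of s y' z j] unfolding y'_def by simp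
  have "y' - x = y - x - of_int z" unfolding y'_def by linarith
  then have "\<bar>y' - x\<bar> * 5 ^ j < 1" using assms by (simp only:)
  from adjacent_cells_diaries[OF close_imp_adjacent_cells[OF this], of j s]
  have adj: "if cell s x j = cell s y' j then digits s x j = digits s y j
         else (0 < j \<longrightarrow> cell s x j mod 5 \<noteq> cell s y' j mod 5) \<and>
              (\<exists>u v w. diary (digits s x j) = v @ u \<and> diary (digits s y j) = w @ u
                       \<and> length v \<le> 1 \<and> length w \<le> 1)"
    unfolding dy by simp
  show "digits s x j = digits s y j \<or> (0 < j \<and> digits s x j ! 0 \<noteq> digits s y j ! 0)"
  proof (cases "j = 0 \<or> cell s x j = cell s y' j")
    case True
    then show ?thesis using adj by auto
  next
    case False
    then show ?thesis using adj digits_nth[of 0 j s x] digits_nth[of 0 j s y'] dy by auto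
  qed
  show "\<exists>u v w. diary (digits s x j) = v @ u \<and> diary (digits s y j) = w @ u
                       \<and> length v \<le> 1 \<and> length w \<le> 1"
  proof (cases "cell s x j = cell s y' j")
    case True
    then have "digits s x j = digits s y j" using adj by auto
    then show ?thesis by (intro exI[of _ "diary (digits s x j)"] exI[of _ "[]"]) auto
  next
    case False
    then show ?thesis using adj by auto
  qed
qed

section \<open>Distances between diaries\<close>

definition word :: "real \<Rightarrow> real \<Rightarrow> nat \<Rightarrow> entry list list" where
  "word s x k = rev (diary (digits s x k))"

definition letters :: "real \<Rightarrow> real \<Rightarrow> nat \<Rightarrow> nat" where
  "letters s x k = length (diary (digits s x k))"

lemma length_word: "length (word s x k) = letters s x k"
  by (simp add: word_def letters_def)

lemma letters_0 [simp]: "letters s x 0 = 0"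
  by (simp add: letters_def)

lemma letters_Suc:
  "letters s x (Suc k) = letters s x k + (if written (cell s x (Suc k) mod 5) then 1 else 0)"
  by (simp add: letters_def)

lemma letters_mono: "t \<le> k \<Longrightarrow> letters s x t \<le> letters s x k"
  by (rule lift_Suc_mono_le) (simp_all add: letters_Suc)

lemma letters_step:
  assumes "0 < k" "letters s x (k - 1) \<noteq> letters s x k"
  shows "letters s x k = Suc (letters s x (k - 1))" and "kind (digits s x k) = 1"
  using assms letters_Suc[of s x "k - 1"] by (cases k; auto split: if_splits)+

lemma word_prefix:
  assumes "t \<le> k"
  shows "word s x t = take (letters s x t) (word s x k)"
    and "letters s x k - letters s x t \<le> k - t"
proof -
  have "\<exists>v. diary (digits s x k) = v @ diary (digits s x t) \<and> length v \<le> k - t"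
    using assms
  proof (induction k rule: dec_induct)
    case (step n)
    then obtain v where "diary (digits s x n) = v @ diary (digits s x t)" "length v \<le> n - t" by blast
    then show ?case using step.hyps
      by (auto intro!: exI[of _ "_ # v"])
  qed auto
  then obtain v where v: "diary (digits s x k) = v @ diary (digits s x t)" "length v \<le> k - t" by blast
  show "word s x t = take (letters s x t) (word s x k)" "letters s x k - letters s x t \<le> k - t"
    using v by (simp_all add: word_def letters_def)
qed

lemma letters_newest:
  assumes "i \<le> k"
  shows "length (filter written (take i (digits s x k))) + letters s x (k - i) = letters s x k"
proof -
  have "letters s x k = length (filter written (take i (digits s x k) @ drop i (digits s x k)))"
    by (simp add: letters_def length_diary)
  then show ?thesis using drop_digits[OF assms]
    by (simp only: filter_append length_append letters_def length_diary)
qed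

lemma letters_both: "k - j \<le> (letters 0 x k - letters 0 x j) + (letters (1/2) x k - letters (1/2) x j)"
proof (cases "j \<le> k")
  case True
  then show ?thesis
  proof (induction k rule: dec_induct)
    case (step n)
    then show ?case
      using every_level_written[of "Suc n" x] letters_Suc[of 0 x n] letters_Suc[of "1/2" x n]
        letters_mono[of j n 0 x] letters_mono[of j n "1/2" x] by (auto split: if_splits)
  qed simp
qed simp

text \<open>
  Up to level \<open>j\<close> the diaries differ by at most one letter each, and afterwards each level adds
  at most one letter.
\<close>

lemma branch_dist_word_le:
  assumes "\<bar>y - x - of_int z\<bar> * 5 ^ j < 1" "j \<le> k" "j \<le> k'"
  shows "branch_dist (word s x k) (word s y k') \<le> (k - j) + (k' - j) + 2"
proof -
  obtain u v w where d: "diary (digits s x j) = v @ u" "diary (digits s y j) = w @ u"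
    and l: "length v \<le> 1" "length w \<le> 1"
    using close_digits(2)[OF assms(1)] by blast
  have "prefix (word s x j) (word s x k)" "prefix (word s y j) (word s y k')"
    using word_prefix(1)[OF assms(2)] word_prefix(1)[OF assms(3)] take_is_prefix by metis+
  moreover have "prefix (rev u) (word s x j)" "prefix (rev u) (word s y j)"
    unfolding word_def d by auto
  ultimately have "branch_dist (word s x k) (word s y k')
      \<le> (letters s x k - length u) + (letters s y k' - length u)"
    using branch_dist_le[of "rev u" "word s x k" "word s y k'"] prefix_order.trans
    by (metis length_rev length_word)
  moreover have "letters s x j \<le> length u + 1" "letters s y j \<le> length u + 1"
    using l unfolding letters_def d by auto
  ultimately show ?thesis
    using word_prefix(2)[OF assms(2), of s x] word_prefix(2)[OF assms(3), of s y] by linarith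
qed

text \<open>
  The level \<open>j\<close> is the last one up to which the two points have equal digits in some colour,
  and the colour \<open>s\<close> writes at least half of the levels of the point \<open>x\<close> from there on. Assume that the
  words agree except for less than \<open>(k - j)/8\<close> letters at their ends. Among the levels \<open>t\<close> for
  which the word of \<open>x\<close> is still common, take one that maximizes
  \<open>17 \<cdot> (number of letters) - t\<close>: then written levels dominate every final stretch before \<open>t\<close>, and the
  diary at \<open>t\<close> determines at least the last \<open>5(k - j)\<close> levels, or all of them. The point \<open>y\<close> reaches the same diary at some
  level \<open>t'\<close> between \<open>j\<close> and \<open>k'\<close>, so \<open>t\<close> and \<open>t'\<close> are closer than \<open>k - j\<close> and the reading
  is unambiguous: \<open>t = t'\<close>, and the digits of both points agree on the levels \<open>j\<close> and \<open>j + 1\<close>. As the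
  points are close at level \<open>j\<close>, their digits up to \<open>j\<close> then agree too, against the choice
  of \<open>j\<close>.
\<close>

lemma branch_dist_color_ge:
  assumes k: "k' \<le> k" "j \<le> k'"
    and agree: "digits s0 x j = digits s0 y j"
    and maximal: "j < k' \<Longrightarrow> digits s x (Suc j) \<noteq> digits s y (Suc j)"
    and many: "k - j \<le> 2 * (letters s x k - letters s x j)" "7 \<le> k - j"
  shows "k - j \<le> 8 * branch_dist (word s x k) (word s y k')"
proof (rule ccontr)
  assume "\<not> ?thesis"
  then have few: "8 * branch_dist (word s x k) (word s y k') < k - j" by simp
  define n where "n = length (longest_common_prefix (word s x k) (word s y k'))"
  have n: "n \<le> letters s x k" "n \<le> letters s y k'" "8 * (letters s x k - n) < k - j"
    using length_lcp_le[of "word s x k" "word s y k'"] few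
    unfolding n_def branch_dist_def length_word by auto
  have common: "take m (word s x k) = take m (word s y k')" if "m \<le> n" for m
  proof -
    have "take n (word s x k) = take n (word s y k')"
      using longest_common_prefix_prefix1[of "word s x k" "word s y k'"]
        longest_common_prefix_prefix2[of "word s x k" "word s y k'"]
      unfolding n_def by (metis append_eq_conv_conj prefix_def)
    then show ?thesis using that by (metis min.absorb1 take_take)
  qed
  have jk: "j \<le> k" using k by simp
  have nj: "letters s x j \<le> n" "3 * (k - j) \<le> 8 * (n - letters s x j)"
    using many n(3) by linarith+
  \<comment> \<open>The last level of \<open>x\<close> whose word lies in the common part.\<close>
  define t0 where "t0 = (GREATEST t. t \<le> k \<and> letters s x t \<le> n)"
  have t0: "t0 \<le> k" "letters s x t0 \<le> n" and t0_max: "\<And>t. t \<le> k \<Longrightarrow> letters s x t \<le> n \<Longrightarrow> t \<le> t0"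
  proof -
    have "t0 \<le> k \<and> letters s x t0 \<le> n" unfolding t0_def
      by (rule GreatestI_nat[of "\<lambda>t. t \<le> k \<and> letters s x t \<le> n" j k]) (use jk nj in auto)
    then show "t0 \<le> k" "letters s x t0 \<le> n" by auto
    show "t \<le> t0" if "t \<le> k" "letters s x t \<le> n" for t unfolding t0_def
      by (rule Greatest_le_nat[of "\<lambda>t. t \<le> k \<and> letters s x t \<le> n" t k]) (use that in auto)
  qed
  have t0n: "letters s x t0 = n"
  proof (cases "t0 = k")
    case True
    then show ?thesis using t0 n by simp
  next
    case False
    then have "\<not> letters s x (Suc t0) \<le> n" using t0_max[of "Suc t0"] t0(1) by auto
    then show ?thesis using t0(2) letters_Suc[of s x t0] by (auto split: if_splits)
  qed
  have jt0: "j \<le> t0" using t0_max[OF jk] nj by simp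
  \<comment> \<open>Between \<open>r\<close> and \<open>t\<close>, the potential grows by 16 for each written and drops by 1 for each other
    level, so at a maximum every final stretch is balanced.\<close>
  define potential where "potential = (\<lambda>t. 17 * int (letters s x t) - int t)"
  obtain t where t: "t \<in> {j..t0}" and t_max: "\<And>r. r \<in> {j..t0} \<Longrightarrow> potential r \<le> potential t"
  proof -
    have "Max (potential ` {j..t0}) \<in> potential ` {j..t0}" using jt0 by (intro Max_in) auto
    then obtain t where "t \<in> {j..t0}" "potential t = Max (potential ` {j..t0})" by auto
    then show ?thesis using that[of t] by (metis Max_ge finite_atLeastAtMost finite_imageI imageI)
  qed
  define gain where "gain = letters s x t - letters s x j"
  have mono_t: "letters s x j \<le> letters s x t" "letters s x t \<le> n"
    using letters_mono[of j t s x] letters_mono[of t t0 s x] t t0n by auto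
  have gain: "5 * (k - j) + (t - j) \<le> 17 * gain"
    using t_max[of t0] jt0 t0n nj(2) t t0(1) mono_t unfolding potential_def gain_def by auto
  \<comment> \<open>Two letters are needed because one of them may be the letter by which diaries of close points
    differ; this is where \<open>7 \<le> k - j\<close> comes from.\<close>
  have gain2: "2 \<le> gain" using gain many(2) by linarith
  have jt: "j < t" using gain2 t unfolding gain_def by (cases "t = j") auto
  have step_t: "letters s x (t - 1) \<noteq> letters s x t"
  proof
    assume "letters s x (t - 1) = letters s x t"
    then have "potential t < potential (t - 1)" using jt unfolding potential_def by simp
    moreover have "t - 1 \<in> {j..t0}" using jt t by auto
    ultimately show False using t_max by (meson leD)
  qed
  \<comment> \<open>The level at which \<open>y\<close> writes the letter that \<open>x\<close> writes at level \<open>t\<close>.\<close>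
  define t' where "t' = (LEAST r. letters s x t \<le> letters s y r)"
  have ex: "letters s x t \<le> letters s y k'" using mono_t n by simp
  have t'1: "letters s x t \<le> letters s y t'" unfolding t'_def
    by (rule LeastI[of "\<lambda>r. letters s x t \<le> letters s y r", OF ex])
  have t'2: "t' \<le> k'" unfolding t'_def
    by (rule Least_le[of "\<lambda>r. letters s x t \<le> letters s y r", OF ex])
  have pos: "0 < letters s x t" using gain2 unfolding gain_def by simp
  have t'0: "0 < t'" using t'1 pos by (cases "t' = 0") auto
  have t'3: "letters s y (t' - 1) < letters s x t"
    using not_less_Least[of "t' - 1" "\<lambda>r. letters s x t \<le> letters s y r"] t'0
    unfolding t'_def[symmetric] by auto
  have step_t': "letters s y (t' - 1) \<noteq> letters s y t'" using t'1 t'3 by simp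
  have t'4: "letters s y t' = letters s x t"
    using letters_step(1)[OF t'0 step_t'] t'1 t'3 by simp
  have tk: "t \<le> k" using t t0 by simp
  have "word s x t = word s y t'"
    using word_prefix(1)[OF tk, of s x] word_prefix(1)[OF t'2, of s y] t'4 common[OF mono_t(2)] by simp
  then have same: "diary (digits s x t) = diary (digits s y t')" unfolding word_def by simp
  obtain z where z: "\<bar>y - x - of_int z\<bar> * 5 ^ j < 1" using digits_agree_imp_close[OF agree] by blast
  \<comment> \<open>Up to level \<open>j\<close> the two diaries differ by at most one letter, so \<open>y\<close> has written the
    letter in question after level \<open>j\<close>.\<close>
  have "letters s y j \<le> letters s x j + 1"
    using close_digits(2)[OF z, of s] unfolding letters_def by auto
  then have "letters s y j < letters s y t'" using gain2 t'4 unfolding gain_def by simp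
  then have jt': "j < t'" using letters_mono[of t' j s y] by (meson leD leI)
  have cover: "length (take i (digits s x t)) \<le> 17 * length (filter written (take i (digits s x t)))"
    if "i \<le> 17 * gain" for i
  proof (cases "i \<le> t - j")
    case True
    then have "t - i \<in> {j..t0}" "i \<le> t" using t jt by auto
    then show ?thesis using t_max[of "t - i"] letters_newest[of i t s x]
      unfolding potential_def by auto
  next
    case False
    have "length (filter written (take (t - j) (digits s x t))) = gain"
      using letters_newest[of "t - j" t s x] jt unfolding gain_def by simp
    moreover have "take i (digits s x t) = take (t - j) (digits s x t) @ take (i - (t - j)) (drop (t - j) (digits s x t))"
      using False take_add[of "t - j" "i - (t - j)"] by simp
    ultimately have "gain \<le> length (filter written (take i (digits s x t)))" by simp
    then show ?thesis using that by simp
  qed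
  have gaps: "4 * (t' - t) \<le> 17 * gain" "4 * (t - t') \<le> 17 * gain"
    using gain jt jt' tk t'2 k by linarith+
  have k1: "kind (digits s x t) = 1" by (rule letters_step(2)) (use jt step_t in auto)
  have k2: "kind (digits s y t') = 1" by (rule letters_step(2)) (use t'0 step_t' in auto)
  \<comment> \<open>Within the last \<open>17 \<cdot> gain\<close> levels the supply of known levels does not run out, and the shift
    \<open>t' - t\<close> is short enough to be detected.\<close>
  note rec = diary_determines_recent[OF same k1 k2 cover, of "17 * gain", simplified length_digits,
      OF _ gaps]
  have tt': "t = t'" using rec(1) by simp
  have recent: "digits s x t ! i = digits s y t ! i" if "i \<le> t - j" "i < t" for i
    using rec(2)[of i] that gain many(2) tt' by simp
  \<comment> \<open>Close points have different digits at level \<open>j\<close> unless all their digits up to \<open>j\<close> agree, so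
    equality at this single level suffices.\<close>
  have below: "0 < j \<Longrightarrow> digits s x j ! 0 = digits s y j ! 0"
    using recent[of "t - j"] jt digits_nth[of "t - j" t s x] digits_nth[of "t - j" t s y]
      digits_nth[of 0 j s x] digits_nth[of 0 j s y] by simp
  then have "digits s x j = digits s y j" using close_digits(1)[OF z, of s] by blast
  moreover have "cell s x (Suc j) mod 5 = cell s y (Suc j) mod 5"
    using recent[of "t - Suc j"] jt digits_nth[of "t - Suc j" t s x] digits_nth[of "t - Suc j" t s y]
    by simp
  ultimately show False using maximal jt t'2 tt' by simp
qed

lemma word_branching_level_le:
  assumes "k' \<le> k"
  shows "\<exists>j z. j \<le> k' \<and> \<bar>y - x - of_int z\<bar> * 5 ^ j < 1 \<and>
     k + k' - 2 * j \<le> 16 * (branch_dist (word 0 x k) (word 0 y k')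
                          + branch_dist (word (1/2) x k) (word (1/2) y k')) + 14"
proof -
  define P where "P = (\<lambda>j. j \<le> k' \<and> (\<exists>s\<in>{0, 1/2}. digits s x j = digits s y j))"
  define j where "j = (GREATEST j. P j)"
  have P0: "P 0" unfolding P_def by auto
  have Pj: "P j" unfolding j_def by (rule GreatestI_nat[of P 0 k', OF P0]) (simp add: P_def)
  have Pmax: "i \<le> j" if "P i" for i unfolding j_def
    by (rule Greatest_le_nat[of P i k', OF that]) (simp add: P_def)
  obtain s0 where agree: "digits s0 x j = digits s0 y j" using Pj unfolding P_def by blast
  have jk: "j \<le> k'" using Pj unfolding P_def by simp
  have maximal: "digits s x (Suc j) \<noteq> digits s y (Suc j)" if "s \<in> {0, 1/2}" "j < k'" for s
  proof
    assume "digits s x (Suc j) = digits s y (Suc j)"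
    then have "P (Suc j)" using that unfolding P_def by (intro conjI bexI[of _ s]) auto
    then show False using Pmax by fastforce
  qed
  obtain z where z: "\<bar>y - x - of_int z\<bar> * 5 ^ j < 1" using digits_agree_imp_close[OF agree] by blast
  have "k - j \<le> 8 * (branch_dist (word 0 x k) (word 0 y k')
                          + branch_dist (word (1/2) x k) (word (1/2) y k')) + 7"
  proof (cases "7 \<le> k - j")
    case True
    have "k - j \<le> 2 * (letters 0 x k - letters 0 x j)
        \<or> k - j \<le> 2 * (letters (1/2) x k - letters (1/2) x j)"
      using letters_both[of k j x] by linarith
    moreover have "k - j \<le> 8 * branch_dist (word s x k) (word s y k')"
      if "s \<in> {0, 1/2}" "k - j \<le> 2 * (letters s x k - letters s x j)" for s
      using branch_dist_color_ge[OF assms jk agree _ that(2) True] maximal[OF that(1)] by blast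
    ultimately show ?thesis by fastforce
  qed simp
  moreover have "k + k' - 2 * j \<le> 2 * (k - j)" using assms jk by linarith
  ultimately have "k + k' - 2 * j \<le> 16 * (branch_dist (word 0 x k) (word 0 y k')
                          + branch_dist (word (1/2) x k) (word (1/2) y k')) + 14" by linarith
  then show ?thesis using jk z by blast
qed

text \<open>
  The lower bound for the distance in the trees: it controls \<open>k + k' - 2j\<close> for some level \<open>j\<close> at
  which the angles \<open>x\<close> and \<open>y\<close> are still close.
\<close>

lemma word_branching_level:
  "\<exists>j z. j \<le> k \<and> j \<le> k' \<and> \<bar>y - x - of_int z\<bar> * 5 ^ j < 1 \<and>
     k + k' - 2 * j \<le> 16 * (branch_dist (word 0 x k) (word 0 y k')
                          + branch_dist (word (1/2) x k) (word (1/2) y k')) + 14"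
proof (cases "k' \<le> k")
  case True
  then show ?thesis using word_branching_level_le[OF True, of y x] by (meson le_trans)
next
  case False
  then have "k \<le> k'" by simp
  from word_branching_level_le[OF this, of x y] obtain j z where
    j: "j \<le> k" "\<bar>x - y - of_int z\<bar> * 5 ^ j < 1"
    "k' + k - 2 * j \<le> 16 * (branch_dist (word 0 y k') (word 0 x k)
                          + branch_dist (word (1/2) y k') (word (1/2) x k)) + 14" by blast
  have "\<bar>y - x - of_int (- z)\<bar> = \<bar>x - y - of_int z\<bar>" by simp
  then have "\<bar>y - x - of_int (- z)\<bar> * 5 ^ j < 1" using j(2) by (simp only:)
  then show ?thesis using j(1,3) False
    by (intro exI[of _ j] exI[of _ "- z"]) (simp add: branch_dist_commute add.commute)
qed

section \<open>The Minkowski form in polar coordinates\<close>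

lemma polar_coordinates: "\<exists>r x. 0 \<le> r \<and> b = r * cos (2 * pi * x) \<and> c = r * sin (2 * pi * (x::real))"
proof -
  obtain r a where ra: "b = r * cos a" "c = r * sin a" using polar_Ex by blast
  show ?thesis
  proof (cases "0 \<le> r")
    case True
    then show ?thesis using ra by (intro exI[of _ r] exI[of _ "a / (2 * pi)"]) simp
  next
    case False
    have "2 * pi * ((a + pi) / (2 * pi)) = a + pi" by simp
    then show ?thesis using False ra
      by (intro exI[of _ "- r"] exI[of _ "(a + pi) / (2 * pi)"]) simp
  qed
qed

lemma cos_gap_le: "1 - cos (2 * pi * u) \<le> 32 * u\<^sup>2"
proof -
  have "1 - cos (2 * pi * u) = 2 * (sin (pi * u))\<^sup>2"
    using cos_double_sin[of "pi * u"] by (simp add: mult.assoc)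
  also have "(sin (pi * u))\<^sup>2 \<le> (pi * u)\<^sup>2"
    using abs_sin_x_le_abs_x[of "pi * u"] by (rule abs_le_square_iff[THEN iffD1])
  also have "(pi * u)\<^sup>2 \<le> 16 * u\<^sup>2"
    using pi_less_4 power_mono[of pi 4 2] by (simp add: power_mult_distrib mult_right_mono)
  finally show ?thesis by simp
qed

text \<open>
  A weak form of Jordan's inequality, obtained from \<open>\<bar>sin y - y\<bar> \<le> \<bar>y\<bar>\<^sup>3/6\<close>.
\<close>

lemma cos_gap_ge:
  assumes "\<bar>u\<bar> \<le> 1 / 2"
  shows "u\<^sup>2 \<le> 2 * (1 - cos (2 * pi * u))"
proof -
  define y where "y = pi * u"
  have "\<bar>y\<bar> \<le> pi * (1/2)" unfolding y_def abs_mult using assms by (intro mult_mono) auto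
  then have y: "\<bar>y\<bar> \<le> 2" using pi_less_4 by linarith
  have y2: "\<bar>y\<bar>^2 \<le> 4" using power_mono[OF y, of 2] by (simp add: power2_eq_square)
  have "\<bar>sin y - y\<bar> \<le> \<bar>y\<bar> ^ 3 / 6"
    using Maclaurin_sin_bound[of y 3] by (simp add: numeral_eq_Suc sin_coeff_def)
  also have "\<dots> = \<bar>y\<bar>^2 * (\<bar>y\<bar> / 6)" by (simp add: power3_eq_cube power2_eq_square)
  also have "\<dots> \<le> 4 * (\<bar>y\<bar> / 6)" using y2 by (intro mult_right_mono) auto
  finally have "\<bar>y / 3\<bar> \<le> \<bar>sin y\<bar>" by linarith
  then have sq: "(y / 3)\<^sup>2 \<le> (sin y)\<^sup>2" by (rule abs_le_square_iff[THEN iffD1])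
  have "2\<^sup>2 \<le> pi\<^sup>2" by (rule power_mono[OF pi_ge_two]) simp
  then have "4 * u\<^sup>2 \<le> pi\<^sup>2 * u\<^sup>2" by (intro mult_right_mono) auto
  then have "u\<^sup>2 \<le> 4 / 9 * (pi\<^sup>2 * u\<^sup>2)" using zero_le_power2[of u] by linarith
  also have "\<dots> = 4 * (y / 3)\<^sup>2" by (simp add: y_def power_divide power_mult_distrib)
  also have "\<dots> \<le> 4 * (sin y)\<^sup>2" using sq by (rule mult_left_mono) simp
  also have "\<dots> = 2 * (1 - cos (2 * pi * u))"
    using cos_double_sin[of y] by (simp add: y_def mult.assoc)
  finally show ?thesis .
qed

lemma cos_gap_int: "cos (2 * pi * (u - of_int z)) = cos (2 * pi * u)"
  by (simp add: right_diff_distrib cos_diff)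

text \<open>
  Applied to the time-like coordinate \<open>a\<close>, the hyperbolic cosine of the distance from the centre.
\<close>

definition level :: "real \<Rightarrow> nat" where
  "level a = nat \<lfloor>log 5 a\<rfloor>"

lemma level_bounds:
  assumes "1 \<le> a"
  shows "5 ^ level a \<le> a" "a < 5 * 5 ^ level a"
proof -
  have 0: "0 \<le> log 5 a" using assms by simp
  then have "real (level a) \<le> log 5 a" "log 5 a < real (level a) + 1"
    unfolding level_def by linarith+
  then have "5 powr real (level a) \<le> a" "a < 5 powr (real (level a) + 1)"
    using assms by (auto simp: le_log_iff log_less_iff)
  then show "5 ^ level a \<le> a" "a < 5 * 5 ^ level a"
    by (auto simp: powr_realpow powr_add mult.commute)
qed

text \<open>
  Two points of the hyperboloid have time-like coordinates \<open>a\<close>, \<open>a'\<close> and spatial norms \<open>r\<close>, \<open>r'\<close>;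
  if their directions are \<open>2\<pi>x\<close> and \<open>2\<pi>y\<close>, the negated Minkowski form is
  \<open>(a a' - r r') + r r' (1 - cos (2\<pi>(y - x)))\<close>. The first summand is the hyperbolic cosine of the
  difference of the radii, comparable to \<open>a/a' + a'/a\<close>; the second one is comparable to
  \<open>a a' (y - x)\<^sup>2\<close> if \<open>\<bar>y - x\<bar> \<le> 1/2\<close> and both points are away from the centre.
\<close>

context
  fixes a a' r r' :: real
  assumes a: "1 \<le> a" "1 \<le> a'" and r: "0 \<le> r" "0 \<le> r'"
    and sheet: "a\<^sup>2 = 1 + r\<^sup>2" "a'\<^sup>2 = 1 + r'\<^sup>2"
begin

lemma radial_identity: "(a * a' - r * r') * (a * a' + r * r') = a\<^sup>2 + a'\<^sup>2 - 1"
proof -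
  have "(a * a' - r * r') * (a * a' + r * r') = a\<^sup>2 * a'\<^sup>2 - r\<^sup>2 * r'\<^sup>2" by algebra
  also have "\<dots> = a\<^sup>2 + a'\<^sup>2 - 1" unfolding sheet by algebra
  finally show ?thesis .
qed

lemma radial_le: "r \<le> a" "r' \<le> a'" "r * r' \<le> a * a'"
proof -
  show 1: "r \<le> a" "r' \<le> a'"
    by (rule power2_le_imp_le; use a r sheet in simp)+
  show "r * r' \<le> a * a'" using 1 a r by (intro mult_mono) auto
qed

lemma radial_upper: "(a * a' - r * r') * (a * a') \<le> a\<^sup>2 + a'\<^sup>2"
proof -
  have "(a * a' - r * r') * (a * a') \<le> (a * a' - r * r') * (a * a' + r * r')"
    using radial_le r by (intro mult_left_mono) auto
  then show ?thesis using radial_identity by simp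
qed

lemma radial_lower: "a \<le> 2 * a' * (a * a' - r * r')" "a' \<le> 2 * a * (a * a' - r * r')"
proof -
  have "a\<^sup>2 + a'\<^sup>2 - 1 \<le> (a * a' - r * r') * (a * a' + a * a')"
    unfolding radial_identity[symmetric] using radial_le by (intro mult_left_mono) auto
  moreover have "1 \<le> a\<^sup>2" "1 \<le> a'\<^sup>2" using a by (auto simp: one_le_power)
  ultimately have "a * a \<le> a * (2 * a' * (a * a' - r * r'))" "a' * a' \<le> a' * (2 * a * (a * a' - r * r'))"
    by (auto simp: algebra_simps power2_eq_square)
  then show "a \<le> 2 * a' * (a * a' - r * r')" "a' \<le> 2 * a * (a * a' - r * r')"
    using a by (auto simp: mult_le_cancel_left)
qed

lemma form_upper:
  assumes j: "j \<le> level a" "j \<le> level a'" and close: "\<bar>y - x - of_int z\<bar> * 5 ^ j < 1"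
  shows "a * a' - r * r' * cos (2 * pi * (y - x)) \<le> 1000 * 5 ^ (level a + level a' - 2 * j)"
proof -
  obtain p where p: "level a = j + p" using j(1) le_Suc_ex by blast
  obtain q where q: "level a' = j + q" using j(2) le_Suc_ex by blast
  define u where "u = y - x - of_int z"
  define J :: real where "J = 5 ^ j"
  define P :: real where "P = 5 ^ p"
  define R :: real where "R = 5 ^ q"
  have pos: "1 \<le> J" "1 \<le> P" "1 \<le> R" unfolding J_def P_def R_def by auto
  have b: "J * P \<le> a" "a \<le> 5 * J * P" "J * R \<le> a'" "a' \<le> 5 * J * R"
    using level_bounds[OF a(1)] level_bounds[OF a(2)] unfolding p q J_def P_def R_def
    by (auto simp: power_add mult.assoc)
  have uJ: "(\<bar>u\<bar> * J)\<^sup>2 \<le> 1" using close pos unfolding u_def J_def by (intro power_le_one) auto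
  have "a * a \<le> (5 * J * P) * a" "a' * a' \<le> (5 * J * R) * a'"
    using b a by (intro mult_right_mono; simp)+
  moreover have "(5 * J * P) * a \<le> 5 * (P * R) * (a * a')"
  proof -
    have "J * 1 \<le> J * R" using pos by (intro mult_left_mono) auto
    then have "J \<le> a'" using b(3) by linarith
    also have "a' * 1 \<le> a' * R" using pos a by (intro mult_left_mono) auto
    finally have "J \<le> a' * R" by simp
    then have "J * (5 * P * a) \<le> (a' * R) * (5 * P * a)" using pos a by (intro mult_right_mono) auto
    then show ?thesis by (simp add: mult_ac)
  qed
  moreover have "(5 * J * R) * a' \<le> 5 * (P * R) * (a * a')"
  proof -
    have "J * 1 \<le> J * P" using pos by (intro mult_left_mono) auto
    then have "J \<le> a" using b(1) by linarith
    also have "a * 1 \<le> a * P" using pos a by (intro mult_left_mono) auto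
    finally have "J \<le> a * P" by simp
    then have "J * (5 * R * a') \<le> (a * P) * (5 * R * a')" using pos a by (intro mult_right_mono) auto
    then show ?thesis by (simp add: mult_ac)
  qed
  ultimately have "a\<^sup>2 + a'\<^sup>2 \<le> (10 * (P * R)) * (a * a')" unfolding power2_eq_square by simp
  then have "(a * a' - r * r') * (a * a') \<le> (10 * (P * R)) * (a * a')" using radial_upper by simp
  then have 1: "a * a' - r * r' \<le> 10 * (P * R)" using a by (simp add: mult_le_cancel_right)
  have "r * r' * (1 - cos (2 * pi * u)) \<le> (a * a') * (32 * u\<^sup>2)"
    using radial_le cos_gap_le[of u] a r by (intro mult_mono) auto
  also have "\<dots> \<le> ((5 * J * P) * (5 * J * R)) * (32 * u\<^sup>2)"
    using b a pos by (intro mult_right_mono mult_mono) auto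
  also have "\<dots> = 800 * (P * R) * (\<bar>u\<bar> * J)\<^sup>2"
    by (simp add: power_mult_distrib) (simp add: power2_eq_square mult_ac)
  also have "\<dots> \<le> 800 * (P * R) * 1" using uJ pos by (intro mult_left_mono) auto
  finally have "r * r' - r * r' * cos (2 * pi * u) \<le> 800 * (P * R)" by (simp add: right_diff_distrib)
  then have "a * a' - r * r' * cos (2 * pi * u) \<le> 1000 * (P * R)"
    using 1 mult_nonneg_nonneg[of P R] pos by linarith
  moreover have "P * R = 5 ^ (level a + level a' - 2 * j)"
    unfolding p q P_def R_def by (simp add: power_add)
  moreover have "cos (2 * pi * u) = cos (2 * pi * (y - x))" unfolding u_def by (rule cos_gap_int)
  ultimately show ?thesis by simp
qed

text \<open>
  Reduce \<open>y - x\<close> modulo 1 to \<open>u\<close> in \<open>[-1/2, 1/2]\<close> and take the last level \<open>j\<close> with \<open>\<bar>u\<bar> < 5\<^sup>-\<^sup>j\<close>.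
  If \<open>j\<close> is the level of one of the points, the radial part of the form suffices; otherwise
  \<open>\<bar>u\<bar> \<ge> 5\<^sup>-\<^sup>j\<^sup>-\<^sup>1\<close> and the angular part does.
\<close>

lemma form_lower:
  "\<exists>j z. j \<le> level a \<and> j \<le> level a' \<and> \<bar>y - x - of_int z\<bar> * 5 ^ j < 1 \<and>
     5 ^ (level a + level a' - 2 * j) \<le> 1000 * (a * a' - r * r' * cos (2 * pi * (y - x)))"
proof -
  define z where "z = round (y - x)"
  define u where "u = y - x - of_int z"
  define Q where "Q = a * a' - r * r' * cos (2 * pi * (y - x))"
  have u: "\<bar>u\<bar> \<le> 1/2" using of_int_round_abs_le[of "y - x"] unfolding u_def z_def
    by (simp add: abs_minus_commute)
  have cosu: "cos (2 * pi * u) = cos (2 * pi * (y - x))" unfolding u_def by (rule cos_gap_int)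
  have split: "Q = (a * a' - r * r') + r * r' * (1 - cos (2 * pi * u))"
    unfolding Q_def cosu by (simp add: algebra_simps)
  have "0 \<le> r * r' * (1 - cos (2 * pi * u))" using r by simp
  then have Q1: "a * a' - r * r' \<le> Q" unfolding split by simp
  define P where "P = (\<lambda>j. j \<le> min (level a) (level a') \<and> \<bar>u\<bar> * 5 ^ j < 1)"
  define j where "j = (GREATEST j. P j)"
  have P0: "P 0" using u unfolding P_def by simp
  have Pj: "P j" unfolding j_def
    by (rule GreatestI_nat[of P 0 "level a", OF P0]) (simp add: P_def)
  have Pmax: "i \<le> j" if "P i" for i unfolding j_def
    by (rule Greatest_le_nat[of P i "level a", OF that]) (simp add: P_def)
  have j: "j \<le> level a" "j \<le> level a'" "\<bar>u\<bar> * 5 ^ j < 1" using Pj unfolding P_def by auto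
  note lev = level_bounds[OF a(1)] level_bounds[OF a(2)]
  have "5 ^ (level a + level a' - 2 * j) \<le> 1000 * Q"
  proof -
    consider "j = level a" | "j = level a'" | "j < level a" "j < level a'" using j by linarith
    then show ?thesis
    proof cases
      case 1
      have "5 ^ j * 5 ^ (level a' - j) \<le> a'"
        using lev(3) j(2) by (simp flip: power_add)
      also have "\<dots> \<le> 2 * a * Q" using radial_lower(2) Q1 a
        by (meson mult_left_mono order_trans zero_le_mult_iff zero_le_numeral zero_le_one)
      also have "\<dots> \<le> 2 * (5 * 5 ^ j) * Q" using lev(2) 1 Q1 radial_le(3)
        by (intro mult_right_mono) auto
      finally have "5 ^ j * 5 ^ (level a' - j) \<le> 5 ^ j * (10 * Q)" by (simp add: mult_ac)
      then have "5 ^ (level a' - j) \<le> 10 * Q" by simp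
      then show ?thesis using 1 Q1 radial_le(3) by simp
    next
      case 2
      have "5 ^ j * 5 ^ (level a - j) \<le> a"
        using lev(1) j(1) by (simp flip: power_add)
      also have "\<dots> \<le> 2 * a' * Q" using radial_lower(1) Q1 a
        by (meson mult_left_mono order_trans zero_le_mult_iff zero_le_numeral zero_le_one)
      also have "\<dots> \<le> 2 * (5 * 5 ^ j) * Q" using lev(4) 2 Q1 radial_le(3)
        by (intro mult_right_mono) auto
      finally have "5 ^ j * 5 ^ (level a - j) \<le> 5 ^ j * (10 * Q)" by (simp add: mult_ac)
      then have "5 ^ (level a - j) \<le> 10 * Q" by simp
      then show ?thesis using 2 Q1 radial_le(3) by simp
    next
      case 3
      then have "\<not> P (Suc j)" using Pmax[of "Suc j"] by auto
      then have far: "1 \<le> \<bar>u\<bar> * 5 ^ Suc j" using 3 unfolding P_def by auto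
      have big: "5 \<le> a" "5 \<le> a'"
        using lev(1,3) 3 power_increasing[of 1 "level a" "5::real"]
          power_increasing[of 1 "level a'" "5::real"] by auto
      have "a\<^sup>2 \<le> 4 * r\<^sup>2" "a'\<^sup>2 \<le> 4 * r'\<^sup>2"
        using sheet power_mono[OF big(1), of 2] power_mono[OF big(2), of 2] by auto
      then have "a\<^sup>2 \<le> (2 * r)\<^sup>2" "a'\<^sup>2 \<le> (2 * r')\<^sup>2" by (auto simp: power_mult_distrib)
      then have "a \<le> 2 * r" "a' \<le> 2 * r'" using r by (auto intro: power2_le_imp_le)
      then have "a * a' \<le> (2 * r) * (2 * r')" using a r by (intro mult_mono) auto
      then have rr: "a * a' \<le> 4 * (r * r')" by simp
      define K where "K = level a + level a' - 2 * j"
      have K: "level a + level a' = K + 2 * j" unfolding K_def using j by simp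
      have "5 ^ K * (5 ^ j)\<^sup>2 = (5::real) ^ level a * 5 ^ level a'"
        by (simp add: K flip: power_add power_mult)
      also have "\<dots> \<le> a * a'" using lev a by (intro mult_mono) auto
      also have "\<dots> \<le> 4 * (r * r')" by (rule rr)
      finally have big_rr: "5 ^ K * (5 ^ j)\<^sup>2 \<le> 4 * (r * r')" .
      have "5 ^ K * 1 \<le> 5 ^ K * (\<bar>u\<bar> * 5 ^ Suc j)\<^sup>2"
        using far by (intro mult_left_mono one_le_power) auto
      also have "\<dots> = 25 * u\<^sup>2 * (5 ^ K * (5 ^ j)\<^sup>2)"
        by (simp add: power_mult_distrib)
      also have "\<dots> \<le> 25 * u\<^sup>2 * (4 * (r * r'))" using big_rr by (intro mult_left_mono) auto
      also have "\<dots> = 100 * (r * r') * u\<^sup>2" by simp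
      also have "\<dots> \<le> 100 * (r * r') * (2 * (1 - cos (2 * pi * u)))"
        using cos_gap_ge[OF u] r by (intro mult_left_mono) auto
      also have "\<dots> \<le> 200 * Q" unfolding split using radial_le(3) by (simp add: algebra_simps)
      finally show ?thesis using Q1 radial_le(3) unfolding K_def by simp
    qed
  qed
  then show ?thesis using j unfolding Q_def u_def by blast
qed

end

section \<open>Binary codes for diaries\<close>

text \<open>
  A letter is a new level followed by at most sixteen levels from the stack.
\<close>

definition alphabet :: "entry list set" where
  "alphabet = {l. set l \<subseteq> {0..4} \<times> {0..2} \<times> UNIV \<and> length l \<le> 17}"

lemma finite_alphabet: "finite alphabet"
  unfolding alphabet_def by (rule finite_lists_length_le) simp

lemma kind_le: "kind h \<le> 2"
  by (cases h) auto

lemma diary_in_alphabet: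
  assumes "set h \<subseteq> {0..4}"
  shows "set (diary h) \<subseteq> alphabet" and "set (backlog h) \<subseteq> {0..4} \<times> {0..2} \<times> UNIV"
proof -
  have "set (diary h) \<subseteq> alphabet \<and> set (backlog h) \<subseteq> {0..4} \<times> {0..2} \<times> UNIV"
    using assms
  proof (induction h)
    case (Cons a h)
    then have IH: "set (diary h) \<subseteq> alphabet" "set (backlog h) \<subseteq> {0..4} \<times> {0..2} \<times> UNIV" by auto
    have e: "entry a h \<in> {0..4} \<times> {0..2} \<times> UNIV"
      using Cons.prems kind_le[of h] by (auto simp: entry_def)
    have t: "set (take 16 (backlog h)) \<subseteq> {0..4} \<times> {0..2} \<times> UNIV"
      and d: "set (drop 16 (backlog h)) \<subseteq> {0..4} \<times> {0..2} \<times> UNIV"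
      using IH(2) set_take_subset set_drop_subset by fast+
    have "entry a h # take 16 (backlog h) \<in> alphabet" using e t unfolding alphabet_def by auto
    then show ?case using IH e d by auto
  qed simp
  then show "set (diary h) \<subseteq> alphabet" "set (backlog h) \<subseteq> {0..4} \<times> {0..2} \<times> UNIV" by auto
qed

lemma set_word: "set (word s x k) \<subseteq> alphabet"
proof -
  have "set (digits s x k) \<subseteq> {0..4}"
  proof (induction k)
    case (Suc k)
    have "cell s x (Suc k) mod 5 \<in> {0..4}"
      using pos_mod_bound[of 5 "cell s x (Suc k)"] by auto
    then show ?case using Suc by simp
  qed simp
  then show ?thesis unfolding word_def using diary_in_alphabet(1) by simp
qed

lemma block_code_exists:
  assumes "finite A"
  shows "\<exists>(c :: 'a \<Rightarrow> bool list) B. 0 < B \<and> inj_on c A \<and> (\<forall>a\<in>A. length (c a) = B)"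
proof -
  define B where "B = Suc (card A)"
  define W where "W = {xs :: bool list. set xs \<subseteq> UNIV \<and> length xs = B}"
  have fin: "finite W" unfolding W_def by (rule finite_lists_length_eq) simp
  have "card W = 2 ^ B" unfolding W_def using card_lists_length_eq[of "UNIV :: bool set" B] by simp
  moreover have "card A < 2 ^ B" using less_exp[of B] unfolding B_def by linarith
  ultimately obtain c where "c ` A \<subseteq> W" "inj_on c A"
    using card_le_inj[OF assms fin] by auto
  then show ?thesis unfolding W_def B_def by (intro exI[of _ c] exI[of _ B]) (auto simp: B_def)
qed

lemma branch_dist_append [simp]: "branch_dist (z @ u) (z @ v) = branch_dist u v"
proof -
  have "longest_common_prefix (z @ u) (z @ v) = z @ longest_common_prefix u v"
    by (induction z) auto
  then show ?thesis by (simp add: branch_dist_def)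
qed

text \<open>
  Words that differ in a letter have codes that differ within the block of that letter, so at most one block per
  word is lost.
\<close>

lemma branch_dist_block_code:
  fixes c :: "'a \<Rightarrow> bool list"
  assumes B: "0 < B" and inj: "inj_on c A" and len: "\<And>a. a \<in> A \<Longrightarrow> length (c a) = B"
    and w: "set w \<subseteq> A" and v: "set v \<subseteq> A"
  shows "branch_dist (concat (map c w)) (concat (map c v)) \<le> B * branch_dist w v"
    and "B * branch_dist w v \<le> branch_dist (concat (map c w)) (concat (map c v)) + 2 * B"
proof -
  define z where "z = longest_common_prefix w v"
  obtain p where p: "w = z @ p"
    using longest_common_prefix_prefix1[of w v] unfolding z_def prefix_def by auto
  obtain q where q: "v = z @ q"
    using longest_common_prefix_prefix2[of w v] unfolding z_def prefix_def by auto
  have lcp: "longest_common_prefix p q = []"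
  proof -
    have "length z = length z + length (longest_common_prefix p q)"
    proof -
      have "longest_common_prefix (z @ p) (z @ q) = z @ longest_common_prefix p q"
        by (induction z) auto
      then show ?thesis unfolding p[symmetric] q[symmetric] z_def[symmetric]
        by (metis length_append)
    qed
    then show ?thesis by simp
  qed
  have dist: "branch_dist w v = length p + length q"
    unfolding p q branch_dist_append using lcp by (simp add: branch_dist_def)
  have block: "length (concat (map c u)) = B * length u" if "set u \<subseteq> A" for u
    using that len by (induction u) auto
  have len': "length (concat (map c p)) = B * length p" "length (concat (map c q)) = B * length q"
    using block w v unfolding p q by auto
  have red: "branch_dist (concat (map c w)) (concat (map c v))
      = branch_dist (concat (map c p)) (concat (map c q))"
    unfolding p q by simp
  show "branch_dist (concat (map c w)) (concat (map c v)) \<le> B * branch_dist w v"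
    unfolding red dist using branch_dist_le[of "[]" "concat (map c p)" "concat (map c q)"] len'
    by (simp add: distrib_left)
  define l where "l = longest_common_prefix (concat (map c p)) (concat (map c q))"
  have l: "prefix l (concat (map c p))" "prefix l (concat (map c q))"
    unfolding l_def by (rule longest_common_prefix_prefix1 longest_common_prefix_prefix2)+
  have "length l \<le> B"
  proof (cases "p = [] \<or> q = []")
    case True
    then show ?thesis using l by auto
  next
    case False
    then obtain a p' b q' where pq: "p = a # p'" "q = b # q'" by (meson neq_Nil_conv)
    have ab: "a \<in> A" "b \<in> A" "a \<noteq> b" using w v lcp unfolding p q pq by auto
    show ?thesis
    proof (rule ccontr)
      assume "\<not> length l \<le> B"
      then have "B \<le> length l" by simp
      then have "take B l = take B (concat (map c p))" "take B l = take B (concat (map c q))"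
        using l by (auto simp: prefix_def)
      then have "c a = c b" using len[OF ab(1)] len[OF ab(2)] unfolding pq by simp
      then show False using inj ab by (auto dest: inj_onD)
    qed
  qed
  then show "B * branch_dist w v \<le> branch_dist (concat (map c w)) (concat (map c v)) + 2 * B"
    unfolding red dist unfolding branch_dist_def l_def[symmetric] len' by (simp add: distrib_left)
qed

section \<open>The hyperbolic plane in two trees\<close>

text \<open>
  The negated Minkowski form on \<open>\<real>\<^sup>3\<close>, so that the distance in the plane is \<open>arcosh\<close> of \<open>form2\<close>.
\<close>

definition form2 :: "real \<times> real \<times> real \<Rightarrow> real \<times> real \<times> real \<Rightarrow> real" where
  "form2 Y Z = fst Y * fst Z - fst (snd Y) * fst (snd Z) - snd (snd Y) * snd (snd Z)"

definition plane :: "(real \<times> real \<times> real) set" where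
  "plane = {Y. form2 Y Y = 1 \<and> 0 < fst Y}"

lemma plane_ge_1: "Y \<in> plane \<Longrightarrow> 1 \<le> fst Y"
proof -
  assume "Y \<in> plane"
  then have Y: "(fst Y)\<^sup>2 = 1 + (fst (snd Y))\<^sup>2 + (snd (snd Y))\<^sup>2" "0 < fst Y"
    unfolding plane_def form2_def by (auto simp: power2_eq_square)
  then have "1\<^sup>2 \<le> (fst Y)\<^sup>2" by simp
  then show ?thesis by (rule power2_le_imp_le) (use Y(2) in simp)
qed

text \<open>
  The direction of the spatial part, as a fraction of a full turn; arbitrary if that part vanishes.
\<close>

definition angle :: "real \<times> real \<times> real \<Rightarrow> real" where
  "angle Y = (SOME x. \<exists>r\<ge>0. fst (snd Y) = r * cos (2 * pi * x) \<and> snd (snd Y) = r * sin (2 * pi * x))"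

lemma angle: "\<exists>r\<ge>0. fst (snd Y) = r * cos (2 * pi * angle Y) \<and> snd (snd Y) = r * sin (2 * pi * angle Y)"
  unfolding angle_def by (rule someI_ex) (use polar_coordinates in blast)

definition color_word :: "real \<Rightarrow> real \<times> real \<times> real \<Rightarrow> entry list list" where
  "color_word s Y = word s (angle Y) (level (fst Y))"

text \<open>
  The words for the two colours measure the logarithm of the form up to affine bounds: combine
  the estimates of the form and of the words by the same number \<open>k + k' - 2j\<close>. The constants come from
  \<open>1 \<le> ln 5 \<le> 2\<close> and \<open>ln 1000 \<le> 10\<close>.
\<close>

lemma color_words:
  assumes "Y \<in> plane" "Z \<in> plane"
  shows "1 \<le> form2 Y Z"
    and "ln (form2 Y Z) \<le> 10 + 2 * real (16 * (branch_dist (color_word 0 Y) (color_word 0 Z)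
                          + branch_dist (color_word (1/2) Y) (color_word (1/2) Z)) + 14)"
    and "real (branch_dist (color_word s Y) (color_word s Z)) \<le> 12 + ln (form2 Y Z)"
proof -
  obtain r where r: "0 \<le> r" "fst (snd Y) = r * cos (2 * pi * angle Y)"
    "snd (snd Y) = r * sin (2 * pi * angle Y)" using angle by blast
  obtain r' where r': "0 \<le> r'" "fst (snd Z) = r' * cos (2 * pi * angle Z)"
    "snd (snd Z) = r' * sin (2 * pi * angle Z)" using angle by blast
  define a where "a = fst Y"
  define a' where "a' = fst Z"
  define x where "x = angle Y"
  define y where "y = angle Z"
  have a: "1 \<le> a" "1 \<le> a'" using plane_ge_1 assms unfolding a_def a'_def by auto
  have norm: "(r * cos t)\<^sup>2 + (r * sin t)\<^sup>2 = r\<^sup>2" for r t :: real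
    by (simp add: power_mult_distrib flip: distrib_left)
  have "a\<^sup>2 = 1 + ((r * cos (2 * pi * x))\<^sup>2 + (r * sin (2 * pi * x))\<^sup>2)"
    "a'\<^sup>2 = 1 + ((r' * cos (2 * pi * y))\<^sup>2 + (r' * sin (2 * pi * y))\<^sup>2)"
    using assms r r' unfolding plane_def form2_def a_def a'_def x_def y_def
    by (auto simp: power2_eq_square)
  then have sheet: "a\<^sup>2 = 1 + r\<^sup>2" "a'\<^sup>2 = 1 + r'\<^sup>2" unfolding norm by auto
  have form: "form2 Y Z = a * a' - r * r' * cos (2 * pi * (y - x))"
    unfolding form2_def r r' a_def a'_def x_def y_def
    by (simp add: right_diff_distrib cos_diff algebra_simps)
  note hyps = a r(1) r'(1) sheet
  have "r * r' * cos (2 * pi * (y - x)) \<le> r * r' * 1"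
    using r(1) r'(1) by (intro mult_left_mono) auto
  then have low: "a * a' - r * r' \<le> form2 Y Z" unfolding form by simp
  have "1 \<le> a * a' - r * r'"
  proof -
    have "(1 + r * r')\<^sup>2 \<le> (a * a')\<^sup>2"
    proof -
      have "(a * a')\<^sup>2 - (1 + r * r')\<^sup>2 = (r - r')\<^sup>2"
        unfolding power_mult_distrib sheet by (simp add: power2_eq_square algebra_simps)
      then have "0 \<le> (a * a')\<^sup>2 - (1 + r * r')\<^sup>2" by (simp only: zero_le_power2)
      then show ?thesis by (simp only: diff_ge_0_iff_ge)
    qed
    moreover have "0 \<le> a * a'" using a by (intro mult_nonneg_nonneg) linarith+
    ultimately have "1 + r * r' \<le> a * a'" by (rule power2_le_imp_le)
    then show ?thesis by simp
  qed
  then show one: "1 \<le> form2 Y Z" using low by simp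
  have ln5: "1 \<le> ln (5::real)" "ln (5::real) \<le> 2"
  proof -
    have e: "exp 1 \<le> (5::real)" "5 \<le> exp (2::real)"
      using exp_le exp_lower_Taylor_quadratic[of 2] by auto
    show "1 \<le> ln (5::real)" using e(1) by (simp add: ln_ge_iff)
    show "ln (5::real) \<le> 2" using e(2) by (metis ln_exp ln_le_cancel_iff exp_gt_zero zero_less_numeral)
  qed
  have ln1000: "ln (1000::real) \<le> 10"
  proof -
    have "ln (1000::real) \<le> ln (5 ^ 5)" by (subst ln_le_cancel_iff) auto
    then show ?thesis using ln5 by (simp only: ln_realpow)
  qed
  show "ln (form2 Y Z) \<le> 10 + 2 * real (16 * (branch_dist (color_word 0 Y) (color_word 0 Z)
                          + branch_dist (color_word (1/2) Y) (color_word (1/2) Z)) + 14)"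
  proof -
    obtain j z where j: "j \<le> level a" "j \<le> level a'" "\<bar>y - x - of_int z\<bar> * 5 ^ j < 1"
      and g: "level a + level a' - 2 * j \<le> 16 * (branch_dist (color_word 0 Y) (color_word 0 Z)
                          + branch_dist (color_word (1/2) Y) (color_word (1/2) Z)) + 14"
      using word_branching_level[of "level a" "level a'" y x]
      unfolding color_word_def a_def a'_def x_def y_def by blast
    have "ln (form2 Y Z) \<le> ln (1000 * 5 ^ (level a + level a' - 2 * j))"
      using form_upper[OF hyps j] one unfolding form by (subst ln_le_cancel_iff) auto
    also have "\<dots> = ln 1000 + real (level a + level a' - 2 * j) * ln 5"
      by (simp add: ln_mult ln_realpow)
    also have "\<dots> \<le> 10 + real (level a + level a' - 2 * j) * 2"
      using ln1000 ln5 by (intro add_mono mult_left_mono) auto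
    also have "\<dots> \<le> 10 + real (16 * (branch_dist (color_word 0 Y) (color_word 0 Z)
                          + branch_dist (color_word (1/2) Y) (color_word (1/2) Z)) + 14) * 2"
      using of_nat_mono[OF g, where 'a = real] by (intro add_left_mono mult_right_mono) auto
    finally show ?thesis by (simp only: mult.commute)
  qed
  show "real (branch_dist (color_word s Y) (color_word s Z)) \<le> 12 + ln (form2 Y Z)"
  proof -
    obtain j z where j: "j \<le> level a" "j \<le> level a'" "\<bar>y - x - of_int z\<bar> * 5 ^ j < 1"
      and g: "5 ^ (level a + level a' - 2 * j) \<le> 1000 * form2 Y Z"
      using form_lower[OF hyps, of y x] unfolding form by blast
    have "branch_dist (color_word s Y) (color_word s Z) \<le> (level a - j) + (level a' - j) + 2"
      unfolding color_word_def using branch_dist_word_le[OF j(3,1,2)]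
      unfolding a_def a'_def x_def y_def .
    then have bd: "real (branch_dist (color_word s Y) (color_word s Z)) \<le> real (level a + level a' - 2 * j) + 2"
      using j by linarith
    have "real (level a + level a' - 2 * j) * 1 \<le> real (level a + level a' - 2 * j) * ln 5"
      using ln5 by (intro mult_left_mono) auto
    also have "\<dots> = ln (5 ^ (level a + level a' - 2 * j))" by (simp add: ln_realpow)
    also have "\<dots> \<le> ln (1000 * form2 Y Z)" using g one by (subst ln_le_cancel_iff) auto
    also have "\<dots> = ln 1000 + ln (form2 Y Z)" using one by (simp add: ln_mult)
    finally show ?thesis using bd ln1000 by simp
  qed
qed

lemma plane_to_two_trees:
  "\<exists>(F :: bool \<Rightarrow> real \<times> real \<times> real \<Rightarrow> bool list) L C. 1 \<le> L \<and> 0 \<le> C \<and> (\<forall>Y\<in>plane. \<forall>Z\<in>plane.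
     ln (form2 Y Z) \<le> L * (real (branch_dist (F False Y) (F False Z))
                        + real (branch_dist (F True Y) (F True Z))) + C \<and>
     real (branch_dist (F False Y) (F False Z)) + real (branch_dist (F True Y) (F True Z))
       \<le> L * ln (form2 Y Z) + C)"
proof -
  obtain c :: "entry list \<Rightarrow> bool list" and B where B: "0 < B" and inj: "inj_on c alphabet"
    and len: "\<And>l. l \<in> alphabet \<Longrightarrow> length (c l) = B"
    using block_code_exists[OF finite_alphabet] by blast
  define F where "F t Y = concat (map c (color_word (if t then 1/2 else 0) Y))" for t Y
  have 1: "real (branch_dist (F t Y) (F t Z))
        \<le> B * real (branch_dist (color_word (if t then 1/2 else 0) Y) (color_word (if t then 1/2 else 0) Z))"
    and 2: "real (branch_dist (color_word (if t then 1/2 else 0) Y) (color_word (if t then 1/2 else 0) Z))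
        \<le> real (branch_dist (F t Y) (F t Z)) + 2" for t Y Z
  proof -
    define S where "S = branch_dist (color_word (if t then 1/2 else 0) Y) (color_word (if t then 1/2 else 0) Z)"
    define b where "b = branch_dist (F t Y) (F t Z)"
    have *: "b \<le> B * S" "B * S \<le> b + 2 * B"
      using branch_dist_block_code[OF B inj len set_word set_word]
      unfolding b_def S_def F_def color_word_def by auto
    show "real b \<le> B * real S" using of_nat_mono[OF *(1), where 'a = real] by simp
    have "S \<le> b + 2"
    proof (cases "S \<le> 2")
      case False
      then obtain d where d: "S = 2 + d" using le_Suc_ex[of 2 S] by auto
      then have "B * d \<le> b" using *(2) by (simp add: distrib_left)
      moreover have "d \<le> B * d" using B by simp
      ultimately show ?thesis using d by linarith
    qed simp
    then show "real S \<le> real b + 2" by linarith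
  qed
  have "ln (form2 Y Z) \<le> (32 + 2 * B) * (real (branch_dist (F False Y) (F False Z))
                        + real (branch_dist (F True Y) (F True Z))) + (166 + 24 * B)"
    and "real (branch_dist (F False Y) (F False Z)) + real (branch_dist (F True Y) (F True Z))
       \<le> (32 + 2 * B) * ln (form2 Y Z) + (166 + 24 * B)" if YZ: "Y \<in> plane" "Z \<in> plane" for Y Z
  proof -
    define b where "b = real (branch_dist (F False Y) (F False Z))
                        + real (branch_dist (F True Y) (F True Z))"
    define S where "S = real (branch_dist (color_word 0 Y) (color_word 0 Z))
                          + real (branch_dist (color_word (1/2) Y) (color_word (1/2) Z))"
    have "S \<le> b + 4" using 2[of False Y Z] 2[of True Y Z] unfolding S_def b_def by simp
    moreover have "ln (form2 Y Z) \<le> 10 + 2 * (16 * S + 14)"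
      using color_words(2)[OF YZ] unfolding S_def by simp
    moreover have "0 \<le> B * b" unfolding b_def by simp
    ultimately have "ln (form2 Y Z) \<le> (32 + 2 * B) * b + (166 + 24 * B)"
      by (simp add: distrib_right)
    then show "ln (form2 Y Z) \<le> (32 + 2 * B) * (real (branch_dist (F False Y) (F False Z))
                        + real (branch_dist (F True Y) (F True Z))) + (166 + 24 * B)"
      unfolding b_def .
    have "b \<le> B * S" using 1[of False Y Z] 1[of True Y Z] unfolding S_def b_def by (simp add: distrib_left)
    also have "\<dots> \<le> B * (24 + 2 * ln (form2 Y Z))"
      using color_words(3)[OF YZ, of 0] color_words(3)[OF YZ, of "1/2"] unfolding S_def
      by (intro mult_left_mono) auto
    also have "\<dots> \<le> (32 + 2 * B) * ln (form2 Y Z) + (166 + 24 * B)"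
      using color_words(1)[OF YZ] by (simp add: algebra_simps)
    finally show "real (branch_dist (F False Y) (F False Z)) + real (branch_dist (F True Y) (F True Z))
       \<le> (32 + 2 * B) * ln (form2 Y Z) + (166 + 24 * B)" unfolding b_def .
  qed
  note bounds = this
  have "1 \<le> real (32 + 2 * B)" "0 \<le> real (166 + 24 * B)" by simp_all
  note const_bounds = this
  show ?thesis
    by (rule exI[of _ F], rule exI[of _ "real (32 + 2 * B)"], rule exI[of _ "real (166 + 24 * B)"])
      (use bounds const_bounds in blast)
qed

section \<open>Horospherical slices of hyperbolic space\<close>

text \<open>
  With \<open>t = 1 / (X\<^sub>0 - X\<^sub>n)\<close> and \<open>x\<^sub>m = t X\<^sub>m\<close>, the horospherical coordinates of \<open>X\<close>, this is the point
  of the hyperbolic plane with coordinates \<open>(x\<^sub>m, t)\<close>: it keeps \<open>X\<^sub>m\<close> and \<open>X\<^sub>0 - X\<^sub>n\<close>, and its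
  remaining light-like coordinate \<open>B\<close> is forced by the equation of the hyperboloid.
\<close>

definition slice :: "nat \<Rightarrow> (nat \<Rightarrow> real) \<Rightarrow> nat \<Rightarrow> real \<times> real \<times> real" where
  "slice n X m = (let A = X 0 - X n; B = (1 + (X m)\<^sup>2) / A in ((A + B) / 2, X m, (B - A) / 2))"

lemma minkowski_Suc:
  "minkowski (Suc N) X Y = (\<Sum>m<N. X (Suc m) * Y (Suc m)) + X (Suc N) * Y (Suc N) - X 0 * Y 0"
  by (simp add: minkowski_def sum.atLeast1_atMost_eq)

lemma hyperbolic_space_D:
  assumes "X \<in> hyperbolic_space (Suc N)"
  shows "0 < X 0 - X (Suc N)"
    and "X 0 + X (Suc N) = (1 + (\<Sum>m<N. (X (Suc m))\<^sup>2)) / (X 0 - X (Suc N))"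
proof -
  have m: "(\<Sum>m<N. (X (Suc m))\<^sup>2) + (X (Suc N))\<^sup>2 - (X 0)\<^sup>2 = -1" and X0: "0 < X 0"
    using assms unfolding hyperbolic_space_def minkowski_Suc by (auto simp: power2_eq_square)
  have "0 \<le> (\<Sum>m<N. (X (Suc m))\<^sup>2)" by (intro sum_nonneg) auto
  then have "(X (Suc N))\<^sup>2 < (X 0)\<^sup>2" using m by linarith
  then have "X (Suc N) < X 0" by (rule power2_less_imp_less) (use X0 in simp)
  then show pos: "0 < X 0 - X (Suc N)" by simp
  have "(X 0 + X (Suc N)) * (X 0 - X (Suc N)) = (X 0)\<^sup>2 - (X (Suc N))\<^sup>2"
    by (simp add: algebra_simps power2_eq_square)
  also have "\<dots> = 1 + (\<Sum>m<N. (X (Suc m))\<^sup>2)" using m by simp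
  finally show "X 0 + X (Suc N) = (1 + (\<Sum>m<N. (X (Suc m))\<^sup>2)) / (X 0 - X (Suc N))"
    using pos by (simp add: eq_divide_eq)
qed

lemma slice_in_plane:
  assumes "0 < X 0 - X n"
  shows "slice n X m \<in> plane"
proof -
  define A where "A = X 0 - X n"
  define B where "B = (1 + (X m)\<^sup>2) / A"
  have s: "slice n X m = ((A + B) / 2, X m, (B - A) / 2)"
    unfolding slice_def A_def B_def by (simp add: Let_def)
  have AB: "A * B = 1 + X m * X m"
    using assms unfolding B_def A_def by (simp add: power2_eq_square)
  have "form2 (slice n X m) (slice n X m) = A * B - X m * X m"
    unfolding s form2_def by (simp add: field_simps)
  then have "form2 (slice n X m) (slice n X m) = 1" unfolding AB by simp
  moreover have "0 \<le> B" using assms unfolding B_def A_def by simp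
  ultimately show ?thesis using assms unfolding plane_def s A_def by simp
qed

text \<open>
  Here \<open>P = (A/A' + A'/A)/2\<close> with \<open>A = X\<^sub>0 - X\<^sub>n\<close> and \<open>A' = Y\<^sub>0 - Y\<^sub>n\<close> is the hyperbolic cosine of the distance
  of the horospheres, and \<open>s\<^sub>m = A A' (X\<^sub>m/A - Y\<^sub>m/A')\<^sup>2 / 2\<close> is the contribution of the \<open>m\<close>-th coordinate
  along them.
\<close>

lemma slice_forms:
  assumes X: "X \<in> hyperbolic_space (Suc N)" and Y: "Y \<in> hyperbolic_space (Suc N)"
  shows "\<exists>P s. 1 \<le> P \<and> (\<forall>m<N. 0 \<le> s m \<and> form2 (slice (Suc N) X (Suc m)) (slice (Suc N) Y (Suc m)) = P + s m) \<and>
     - minkowski (Suc N) X Y = P + (\<Sum>m<N. s m)"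
proof -
  define A where "A = X 0 - X (Suc N)"
  define A' where "A' = Y 0 - Y (Suc N)"
  have pos: "0 < A" "0 < A'" using hyperbolic_space_D(1) X Y unfolding A_def A'_def by auto
  define P where "P = (A / A' + A' / A) / 2"
  define s where "s m = (A / A' * (Y (Suc m))\<^sup>2 + A' / A * (X (Suc m))\<^sup>2) / 2 - X (Suc m) * Y (Suc m)" for m
  have "P - 1 = (A - A')\<^sup>2 / (2 * A * A')"
    using pos unfolding P_def by (simp add: field_simps power2_eq_square)
  moreover have "0 \<le> (A - A')\<^sup>2 / (2 * A * A')" using pos by simp
  ultimately have P: "1 \<le> P" by linarith
  have s: "0 \<le> s m" for m
  proof -
    have "s m = (A' * X (Suc m) - A * Y (Suc m))\<^sup>2 / (2 * A * A')"
      using pos unfolding s_def by (simp add: field_simps power2_eq_square)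
    then show ?thesis using pos by simp
  qed
  have form: "form2 (slice (Suc N) X (Suc m)) (slice (Suc N) Y (Suc m)) = P + s m" for m
    using pos unfolding slice_def form2_def Let_def A_def[symmetric] A'_def[symmetric] P_def s_def
    by (simp add: field_simps)
  have "- minkowski (Suc N) X Y
      = (A * (Y 0 + Y (Suc N)) + A' * (X 0 + X (Suc N))) / 2 - (\<Sum>m<N. X (Suc m) * Y (Suc m))"
    unfolding minkowski_Suc A_def A'_def by (simp add: field_simps)
  also have "\<dots> = P + ((A / A' * (\<Sum>m<N. (Y (Suc m))\<^sup>2) + A' / A * (\<Sum>m<N. (X (Suc m))\<^sup>2)) / 2
        - (\<Sum>m<N. X (Suc m) * Y (Suc m)))"
    unfolding hyperbolic_space_D(2)[OF X] hyperbolic_space_D(2)[OF Y] A_def[symmetric] A'_def[symmetric]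
      P_def using pos by (simp add: field_simps)
  also have "\<dots> = P + (\<Sum>m<N. s m)"
    unfolding s_def by (simp add: sum_subtractf sum.distrib sum_distrib_left flip: sum_divide_distrib)
  finally show ?thesis using P s form by blast
qed

text \<open>
  Multiply out \<open>\<Prod>m. (P + s\<^sub>m)\<close> and use \<open>P \<ge> 1\<close>.
\<close>

lemma ln_add_sum_le:
  fixes s :: "nat \<Rightarrow> real"
  assumes "1 \<le> P" "\<And>m. m \<le> N \<Longrightarrow> 0 \<le> s m"
  shows "ln (P + (\<Sum>m\<le>N. s m)) \<le> (\<Sum>m\<le>N. ln (P + s m))"
  using assms(2)
proof (induction N)
  case (Suc N)
  define S where "S = (\<Sum>m\<le>N. s m)"
  define t where "t = s (Suc N)"
  have nn: "0 \<le> S" "0 \<le> t" using Suc.prems unfolding S_def t_def by (auto intro: sum_nonneg)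
  have "P * 1 \<le> P * P" "S * 1 \<le> S * P" "1 * t \<le> P * t" "0 \<le> S * t"
    using assms(1) nn mult_left_mono[of 1 P P] mult_left_mono[of 1 P S] mult_right_mono[of 1 P t] by auto
  moreover have "(P + S) * (P + t) = P * P + S * P + P * t + S * t" by (simp add: algebra_simps)
  ultimately have "P + (S + t) \<le> (P + S) * (P + t)" by linarith
  then have "ln (P + (S + t)) \<le> ln ((P + S) * (P + t))"
    using assms(1) nn by (subst ln_le_cancel_iff) (auto intro!: mult_pos_pos)
  also have "\<dots> = ln (P + S) + ln (P + t)" using assms(1) nn by (simp add: ln_mult)
  finally show ?case using Suc unfolding S_def t_def by fastforce
qed simp

lemma arcosh_ln_bounds:
  assumes "1 \<le> (q::real)"
  shows "ln q \<le> arcosh q" "arcosh q \<le> ln q + 1"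
proof -
  have s: "0 \<le> sqrt (q\<^sup>2 - 1)" "sqrt (q\<^sup>2 - 1) \<le> q"
    using assms by (auto intro!: real_le_lsqrt simp: one_le_power)
  then have pos: "0 < q" "0 < q + sqrt (q\<^sup>2 - 1)" using assms by linarith+
  show "ln q \<le> arcosh q" unfolding arcosh_real_def[OF assms] using pos s
    by (subst ln_le_cancel_iff) auto
  have "arcosh q \<le> ln (2 * q)" unfolding arcosh_real_def[OF assms] using pos s
    by (subst ln_le_cancel_iff) auto
  also have "\<dots> = ln 2 + ln q" using assms by (simp add: ln_mult)
  finally show "arcosh q \<le> ln q + 1" using ln_2_less_1 by simp
qed

lemma sum_pairs: "(\<Sum>i<2 * N. f i) = (\<Sum>m<N. f (2 * m) + f (2 * m + 1))" for f :: "nat \<Rightarrow> real"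
  by (induction N) auto

theorem corollary1p3:
  fixes n :: nat
  assumes "n \<ge> 2"
  shows "\<exists>\<psi>. quasi_isometric_embedding
           (hyperbolic_space n) (hyperbolic_dist n)
           (tree_power (2 * (n - 1))) (tree_power_dist (2 * (n - 1))) \<psi>"
proof -
  define N where "N = n - 1"
  have n: "n = Suc N" "1 \<le> N" using assms unfolding N_def by auto
  obtain F :: "bool \<Rightarrow> real \<times> real \<times> real \<Rightarrow> bool list" and L C where LC: "1 \<le> L" "0 \<le> C" and F:
    "\<And>Y Z. Y \<in> plane \<Longrightarrow> Z \<in> plane \<Longrightarrow> ln (form2 Y Z) \<le> L * (real (branch_dist (F False Y) (F False Z))
                        + real (branch_dist (F True Y) (F True Z))) + C"
    "\<And>Y Z. Y \<in> plane \<Longrightarrow> Z \<in> plane \<Longrightarrow> real (branch_dist (F False Y) (F False Z))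
         + real (branch_dist (F True Y) (F True Z)) \<le> L * ln (form2 Y Z) + C"
    using plane_to_two_trees by blast
  have LN: "1 \<le> N * L + L"
    using LC mult_nonneg_nonneg[of "real N" L] by linarith
  \<comment> \<open>Slice \<open>m + 1\<close> uses the factors \<open>2m\<close> and \<open>2m + 1\<close>, one for each colour.\<close>
  define \<psi> where "\<psi> X = (\<lambda>i\<in>{..<2 * N}. vertex (F (odd i) (slice n X (Suc (i div 2)))))" for X
  define D where "D X Y = (\<Sum>m<N. real (branch_dist (F False (slice n X (Suc m))) (F False (slice n Y (Suc m))))
      + real (branch_dist (F True (slice n X (Suc m))) (F True (slice n Y (Suc m)))))" for X Y
  have dist: "tree_power_dist (2 * N) (\<psi> X) (\<psi> Y) = D X Y" for X Y
    unfolding tree_power_dist_def D_def sum_pairs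
    by (rule sum.cong) (auto simp: \<psi>_def tree_dist_vertex)
  have "\<psi> \<in> hyperbolic_space n \<rightarrow> tree_power (2 * N)"
    unfolding tree_power_def \<psi>_def using vertex_in_tree by auto
  moreover have "hyperbolic_dist n X Y / (N * L + L) - (N * C + C + 1) \<le> D X Y
      \<and> D X Y \<le> (N * L + L) * hyperbolic_dist n X Y + (N * C + C + 1)"
    if X: "X \<in> hyperbolic_space n" and Y: "Y \<in> hyperbolic_space n" for X Y
  proof -
    define q where "q = - minkowski n X Y"
    obtain P s where P: "1 \<le> P"
      and s: "\<And>m. m < N \<Longrightarrow> 0 \<le> s m"
        "\<And>m. m < N \<Longrightarrow> form2 (slice n X (Suc m)) (slice n Y (Suc m)) = P + s m"
      and q: "q = P + (\<Sum>m<N. s m)"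
      using slice_forms[of X N Y] X Y unfolding n(1) q_def by blast
    have sl: "slice n X m \<in> plane" "slice n Y m \<in> plane" for m
      using slice_in_plane hyperbolic_space_D(1) X Y unfolding n(1) by blast+
    have nn: "0 \<le> (\<Sum>m<N. s m)" using s(1) by (intro sum_nonneg) auto
    have q1: "1 \<le> q" using P nn q by simp
    have d: "ln q \<le> hyperbolic_dist n X Y" "hyperbolic_dist n X Y \<le> ln q + 1"
      using arcosh_ln_bounds[OF q1] unfolding hyperbolic_dist_def q_def by auto
    define T where "T m = real (branch_dist (F False (slice n X (Suc m))) (F False (slice n Y (Suc m))))
      + real (branch_dist (F True (slice n X (Suc m))) (F True (slice n Y (Suc m))))" for m
    have DT: "D X Y = (\<Sum>m<N. T m)" unfolding D_def T_def ..
    have T: "ln (P + s m) \<le> L * T m + C" "T m \<le> L * ln (P + s m) + C" if "m < N" for m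
      using F(1)[OF sl, of "Suc m" "Suc m"] F(2)[OF sl, of "Suc m" "Suc m"] s(2)[OF that] unfolding T_def by auto
    have "T m \<le> L * ln q + C" if "m < N" for m
    proof -
      have "s m \<le> (\<Sum>m<N. s m)" using s(1) that by (intro member_le_sum) auto
      then have "ln (P + s m) \<le> ln q" using P s(1)[OF that] q by (subst ln_le_cancel_iff) auto
      then have "L * ln (P + s m) \<le> L * ln q" using LC by (intro mult_left_mono) auto
      then show ?thesis using T(2)[OF that] by linarith
    qed
    then have "D X Y \<le> N * (L * ln q + C)"
      unfolding DT using sum_bounded_above[of "{..<N}" T "L * ln q + C"] by simp
    also have "\<dots> \<le> N * (L * hyperbolic_dist n X Y + C)"
      using d(1) LC by (intro mult_left_mono add_right_mono) auto
    also have "\<dots> \<le> (N * L + L) * hyperbolic_dist n X Y + (N * C + C + 1)"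
      using LC d(1) ln_ge_zero[OF q1] by (simp add: algebra_simps)
    finally have upper: "D X Y \<le> (N * L + L) * hyperbolic_dist n X Y + (N * C + C + 1)" .
    have "ln q \<le> (\<Sum>m<N. ln (P + s m))"
    proof -
      have "{..<N} = {..N - 1}" using n(2) by auto
      then show ?thesis using ln_add_sum_le[OF P, of "N - 1" s] s(1) n(2) unfolding q by auto
    qed
    also have "\<dots> \<le> (\<Sum>m<N. L * T m + C)" by (rule sum_mono) (use T(1) in auto)
    also have "\<dots> = L * D X Y + N * C" unfolding DT by (simp add: sum.distrib sum_distrib_left)
    finally have "hyperbolic_dist n X Y \<le> L * D X Y + (N * C + 1)" using d(2) by simp
    also have "\<dots> \<le> (N * L + L) * (D X Y + (N * C + C + 1))"
    proof -
      have "0 \<le> D X Y" unfolding DT T_def by (intro sum_nonneg) auto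
      then have "L * D X Y \<le> (N * L + L) * D X Y" using LC by (intro mult_right_mono) auto
      moreover have "1 * (N * C + 1) \<le> (N * L + L) * (N * C + C + 1)"
        using LC LN by (intro mult_mono) auto
      ultimately show ?thesis by (simp add: distrib_left)
    qed
    finally have "hyperbolic_dist n X Y / (N * L + L) \<le> D X Y + (N * C + C + 1)"
      using LC by (simp add: divide_le_eq add_nonneg_pos mult.commute)
    then show ?thesis using upper by simp
  qed
  moreover note LN
  moreover have "0 \<le> N * C + C + 1" using LC by simp
  ultimately have "quasi_isometric_embedding (hyperbolic_space n) (hyperbolic_dist n)
      (tree_power (2 * N)) (tree_power_dist (2 * N)) \<psi>"
    unfolding quasi_isometric_embedding_def dist by blast
  then show ?thesis unfolding N_def by blast
qed

end
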